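(* Let $\nu$ be a dislocation measure satisfying assumptions (1)–(4) of the context, and let $f:[0,1]\to\mathbb{R}$ be continuous. With $\epsilon=e^{-T}$, $$\gamma_T(f)=\sum_{u\in\mathcal{U}_\epsilon}\xi_u f\left(\frac{\xi_u}{\epsilon}\right)\longrightarrow\gamma_\infty(f)\quad\text{almost surely as }T\to+\infty .$$
   Context: Let $\mathcal{S}^{\downarrow}=\{\mathbf{s}=(s_1,s_2,\dots): s_1\ge s_2\ge\dots\ge 0,\ \sum_i s_i\le 1\}$. The dislocation measure $\nu$ is a measure on $\mathcal{S}^{\downarrow}$ satisfying: (1) $\nu(\mathcal{S}^{\downarrow})=1$ and $\nu(s_1\in(0,1))=1$; (2) (conservative) $\nu(\sum_i s_i=1)=1$. Let $\pi$ be the probability measure on $(0,\infty)$ defined by $\int\sum_i s_if(s_i)\,\nu(d\mathbf{s})=\int_0^\infty f(e^{-x})\,\pi(dx)$ for all bounded measurable $f:[0,1]\to[0,\infty)$. (3) There are $0<a<b<\infty$ such that the support of $\pi$ is $[a,b]$. (4) $\pi$ has a density with respect to Lebesgue measure which is continuous on $(0,\infty)$. Fragmentation. Let $\mathcal{U}=\{0\}\cup\bigcup_{n\ge1}(\mathbb{N}^* )^n$ be the infinite genealogical tree with root $0$ (the empty word); the $i$-th child of $u=(u_1,\dots,u_n)$ is $ui=(u_1,\dots,u_n,i)$, and $\boldsymbol{m}(u)$ denotes the mother of $u\ne0$. Let $((\widetilde\xi_{ui})_{i\ge1},u\in\mathcal{U})$ be i.i.d. sequences of law $\nu$, and set $\xi_0=1$,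 $\xi_{ui}=\widetilde\xi_{ui}\xi_u$ ($\xi_u$ is the size of fragment $u$). For $\epsilon\in(0,1)$ put $T=-\log\epsilon$ and $\mathcal{U}_\epsilon=\{u\in\mathcal{U}\setminus\{0\}:\xi_{\boldsymbol{m}(u)}\ge\epsilon,\ \xi_u<\epsilon\}$. Limit. Let $\mu=\int x\,\pi(dx)$ and let $\eta$ be the probability measure on $\mathbb{R}^+$ given by $\eta(g)=\frac1\mu\int_0^\infty \mathbb{E}(g(Y-s)\mathbf{1}_{\{Y-s>0\}})\,ds$ with $Y\sim\pi$, for bounded measurable $g$. For $f:[0,1]\to\mathbb{R}$ let $\Phi(f)(y)=f(e^{-y})$, $y\ge0$, and $\gamma_\infty(f)=\eta(\Phi(f))$. *)

theory Defs
  imports "HOL-Probability.Probability"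
begin

text \<open>Sequences are indexed from 0, so \<open>s 0\<close> is the largest mass \<open>s\<^sub>1\<close>.\<close>

definition ranked_masses :: "(nat \<Rightarrow> real) set" where
  "ranked_masses = {s. decseq s \<and> (\<forall>i. 0 \<le> s i) \<and> summable s \<and> (\<Sum>i. s i) \<le> 1}"

abbreviation ranked_masses_space :: "(nat \<Rightarrow> real) measure" where
  "ranked_masses_space \<equiv> restrict_space (PiM UNIV (\<lambda>_. borel)) ranked_masses"

definition dislocation_measure :: "(nat \<Rightarrow> real) measure \<Rightarrow> bool" where
  "dislocation_measure \<nu> \<longleftrightarrow>
     prob_space \<nu> \<and> sets \<nu> = sets ranked_masses_space \<and>
     (AE s in \<nu>. s 0 \<in> {0<..<1})"

definition conservative :: "(nat \<Rightarrow> real) measure \<Rightarrow> bool" where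
  "conservative \<nu> \<longleftrightarrow> (AE s in \<nu>. (\<Sum>i. s i) = 1)"

text \<open>\<open>step_law \<nu> \<pi>\<close>: \<open>\<pi>\<close> is the law on \<open>(0, \<infinity>)\<close> of minus the logarithm of a
  size-biased fragment of \<open>\<nu>\<close>. The space of \<open>\<pi>\<close> is \<open>{0<..}\<close>, not the whole line.\<close>

definition step_law :: "(nat \<Rightarrow> real) measure \<Rightarrow> real measure \<Rightarrow> bool" where
  "step_law \<nu> \<pi> \<longleftrightarrow>
     prob_space \<pi> \<and> sets \<pi> = sets (restrict_space borel {0<..}) \<and>
     (\<forall>f :: real \<Rightarrow> real.
        f \<in> borel_measurable (restrict_space borel {0..1}) \<longrightarrow>
        (\<forall>x\<in>{0..1}. 0 \<le> f x) \<longrightarrow> bounded (f ` {0..1}) \<longrightarrow>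
        (\<integral>s. (\<Sum>i. s i * f (s i)) \<partial>\<nu>) = (\<integral>x. f (exp (- x)) \<partial>\<pi>))"

definition measure_support :: "'a::topological_space measure \<Rightarrow> 'a set" where
  "measure_support M =
     {x \<in> space M. \<forall>U. open U \<longrightarrow> x \<in> U \<longrightarrow> 0 < emeasure M (U \<inter> space M)}"

definition has_continuous_density :: "real measure \<Rightarrow> bool" where
  "has_continuous_density \<pi> \<longleftrightarrow>
     (\<exists>h. continuous_on {0<..} h \<and> (\<forall>x>0. 0 \<le> h x) \<and>
          \<pi> = density (restrict_space lborel {0<..}) (\<lambda>x. ennreal (h x)))"

text \<open>\<open>limit_law \<pi> \<eta>\<close>: \<open>\<eta>\<close> is the stationary overshoot law of the renewal process with
  step law \<open>\<pi>\<close>. The space of \<open>\<eta>\<close> is \<open>{0..}\<close>; the values of \<open>g\<close> at negative arguments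
  are cut off by the indicator.\<close>

definition limit_law :: "real measure \<Rightarrow> real measure \<Rightarrow> bool" where
  "limit_law \<pi> \<eta> \<longleftrightarrow>
     prob_space \<eta> \<and> sets \<eta> = sets (restrict_space borel {0..}) \<and>
     (\<forall>g :: real \<Rightarrow> real.
        g \<in> borel_measurable (restrict_space borel {0..}) \<longrightarrow> bounded (g ` {0..}) \<longrightarrow>
        (\<integral>y. g y \<partial>\<eta>) =
          1 / (\<integral>x. x \<partial>\<pi>) *
          (LBINT s:{0..}. (\<integral>y. g (y - s) * indicator {0<..} (y - s) \<partial>\<pi>)))"

definition \<Phi> :: "(real \<Rightarrow> real) \<Rightarrow> real \<Rightarrow> real" where
  "\<Phi> f y = f (exp (- y))"

definition gamma_limit :: "real measure \<Rightarrow> (real \<Rightarrow> real) \<Rightarrow> real" where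
  "gamma_limit \<eta> f = (\<integral>y. \<Phi> f y \<partial>\<eta>)"

text \<open>A node of the infinite tree is a word stored with its last letter first: the root is
  \<open>[]\<close>, the children of \<open>u\<close> are the words \<open>i # u\<close>, and the mother of \<open>u \<noteq> []\<close> is \<open>tl u\<close>.
  The random sequence \<open>X u\<close> lists the relative sizes of the children of \<open>u\<close>.\<close>

type_synonym node = "nat list"

primrec frag_size :: "(node \<Rightarrow> 'w \<Rightarrow> nat \<Rightarrow> real) \<Rightarrow> 'w \<Rightarrow> node \<Rightarrow> real" where
  "frag_size X \<omega> [] = 1"
| "frag_size X \<omega> (i # u) = X u \<omega> i * frag_size X \<omega> u"

definition frozen_nodes :: "(node \<Rightarrow> 'w \<Rightarrow> nat \<Rightarrow> real) \<Rightarrow> 'w \<Rightarrow> real \<Rightarrow> node set" where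
  "frozen_nodes X \<omega> \<epsilon> =
     {u. u \<noteq> [] \<and> frag_size X \<omega> (tl u) \<ge> \<epsilon> \<and> frag_size X \<omega> u < \<epsilon>}"

text \<open>The frozen nodes form an antichain and may be infinite in number. When every \<open>X u \<omega>\<close>
  lies in \<^const>\<open>ranked_masses\<close> their sizes sum to at most 1, so for \<open>f\<close> bounded on \<open>[0, 1]\<close>
  the unordered sum below converges absolutely and never takes its default value.\<close>

definition gamma_frag ::
    "(node \<Rightarrow> 'w \<Rightarrow> nat \<Rightarrow> real) \<Rightarrow> (real \<Rightarrow> real) \<Rightarrow> real \<Rightarrow> 'w \<Rightarrow> real" where
  "gamma_frag X f T \<omega> =
     (\<Sum>\<^sub>\<infinity>u\<in>frozen_nodes X \<omega> (exp (- T)).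
        frag_size X \<omega> u * f (frag_size X \<omega> u / exp (- T)))"

definition iid_family :: "'w measure \<Rightarrow> 'a measure \<Rightarrow> ('i \<Rightarrow> 'w \<Rightarrow> 'a) \<Rightarrow> bool" where
  "iid_family M \<nu> X \<longleftrightarrow>
     prob_space.indep_vars M (\<lambda>_. \<nu>) X UNIV \<and> (\<forall>u. distr M \<nu> (X u) = \<nu>)"

end

theory Submission
  imports Defs
begin

text \<open>Write \<open>t = T + ln \<xi>\<close> for the level still to be covered below a fragment of size \<open>\<xi>\<close>. The
  branching property says that, as long as \<open>t \<ge> 0\<close>, the sum over the fragments that stop below
  this one is the average, weighted by the relative masses \<open>s\<^sub>i\<close>, of the sums below its children,
  which face the levels \<open>t + ln s\<^sub>i\<close> (\<open>stopped_sum_step\<close>). A fragment with \<open>t < 0\<close> is stopped and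
  contributes \<open>\<phi> (- t)\<close>, where \<open>\<phi> y = f (exp (- y))\<close> and \<open>- t\<close> is the overshoot. Because the
  size-biased steps \<open>- ln s\<^sub>i\<close> lie in a compact interval \<open>[a, b]\<close> with \<open>a > 0\<close>, every fragment
  almost surely has boundedly many children of positive mass and every sum is finite.

  \<^emph>\<open>The mean.\<close> By size biasing, the expectation \<open>g t\<close> of the stopped sum satisfies
  \<open>g t = \<integral> g (t - y) \<pi>(dy)\<close> for \<open>t \<ge> 0\<close>, with the boundary values \<open>g (- y) = \<phi> y\<close>
  (\<open>mean_sum_renewal\<close>). A renewal theorem makes \<open>g\<close> converge. A density makes \<open>g\<close> uniformly
  continuous. If \<open>g\<close> comes close to its limit superior \<open>l\<close> along levels \<open>\<tau>\<^sub>n\<close>, then, being an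
  average of values that are hardly larger than \<open>l\<close>, it is also close to \<open>l\<close> along \<open>\<tau>\<^sub>n - z\<close> for
  every \<open>z\<close> in the support \<open>[a, b]\<close> (\<open>limsup_attained_propagates\<close>). The sets \<open>[k a, k b]\<close> cover
  a half-line, so \<open>g (\<tau>\<^sub>n - y)\<close> tends to \<open>l\<close> for all large \<open>y\<close>. A conserved integral
  (\<open>conserved_const\<close>) then identifies \<open>l\<close> from the boundary values; the same argument for \<open>- g\<close>
  treats the limit inferior (\<open>renewal_equation.converges\<close>). The resulting constant
  \<open>overshoot_mean \<phi>\<close> is the integral of \<open>\<phi>\<close> against the stationary overshoot law
  (\<open>limit_law_integral\<close>).

  \<^emph>\<open>The fluctuations.\<close> Conditionally on the first \<open>k\<close> generations, the stopped sum is a combination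
  of independent variables, weighted by the masses of the \<open>k\<close>-th generation. Those masses sum to 1 and
  are at most \<open>exp (- a k)\<close>, hence the conditional variance is \<open>O(exp (- a k))\<close>
  (\<open>deviation_second_moment\<close>). The conditional mean is an average of values of \<open>g\<close> at levels at
  least \<open>T - k b\<close>. With \<open>T = n \<delta>\<close> and \<open>k\<close> about \<open>T / (2 b)\<close> the conditional mean converges and
  the variances are summable in \<open>n\<close>, which gives almost sure convergence along the grid of multiples
  of \<open>\<delta>\<close> (\<open>converges_on_grid\<close>).

  \<^emph>\<open>Between grid points.\<close> Raising the level by \<open>r \<le> \<delta>\<close> only disturbs the fragments with overshoot
  at most \<open>\<delta>\<close>; the others stay stopped and see their overshoot shifted by \<open>r\<close>. So the change is
  bounded by a stopped sum for another function, \<open>e\<close> plus a multiple of the indicator of \<open>(0, \<delta>]\<close>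
  (\<open>stopped_sum_interpolate\<close>). This sum converges along the same grid, to a limit of order \<open>e + \<delta>\<close>.\<close>

section \<open>The renewal equation for a compactly supported density\<close>

lemma integrable_bounded_indicator:
  "A \<in> sets borel \<Longrightarrow> bounded A \<Longrightarrow> integrable lborel (indicator A :: real \<Rightarrow> real)"
  using emeasure_bounded_finite[of A] by (intro integrable_real_indicator) auto

text \<open>The step law, transported to the whole line: a probability density whose closed support is exactly
  \<open>[a, b]\<close>. Continuity on the whole line includes the end points, so \<open>h\<close> vanishes at \<open>a\<close> and \<open>b\<close>.\<close>
locale step_density =
  fixes h :: "real \<Rightarrow> real" and a b :: real
  assumes a_pos: "0 < a" and a_less_b: "a < b"
    and h_continuous: "continuous_on UNIV h"
    and h_nonneg: "\<And>x. 0 \<le> h x"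
    and h_zero: "\<And>x. x \<notin> {a..b} \<Longrightarrow> h x = 0"
    and h_prob: "prob_space (density lborel (\<lambda>x. ennreal (h x)))"
    and h_support: "\<And>z \<rho>. z \<in> {a..b} \<Longrightarrow> 0 < \<rho> \<Longrightarrow>
          0 < measure (density lborel (\<lambda>x. ennreal (h x))) {z - \<rho><..<z + \<rho>}"
begin

definition Q :: "real measure" where
  "Q = density lborel (\<lambda>x. ennreal (h x))"

lemma h_measurable[measurable]: "h \<in> borel_measurable borel"
  using h_continuous by (rule borel_measurable_continuous_onI)

lemma sets_Q[measurable_cong, simp]: "sets Q = sets borel"
  by (simp add: Q_def)

lemma space_Q[simp]: "space Q = UNIV"
  by (simp add: Q_def)

sublocale Q: prob_space Q
  unfolding Q_def by (rule h_prob)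

lemma integral_Q: "g \<in> borel_measurable borel \<Longrightarrow> (\<integral>y. g y \<partial>Q) = (\<integral>y. h y * g y \<partial>lborel)"
  for g :: "real \<Rightarrow> real"
  unfolding Q_def by (subst integral_density) (auto simp: h_nonneg)

lemma AE_Q: "AE y in Q. y \<in> {a..b}"
proof -
  have "y \<in> {a..b}" if "0 < ennreal (h y)" for y
    using that h_zero[of y] by (cases "y \<in> {a..b}") auto
  then show ?thesis
    unfolding Q_def by (subst AE_density) (auto simp del: atLeastAtMost_iff intro!: AE_I2)
qed

lemma h_integrable: "integrable lborel h"
proof -
  have "(\<integral>\<^sup>+x. ennreal (h x) \<partial>lborel) = emeasure Q (space Q)"
    by (simp add: Q_def emeasure_density)
  also have "\<dots> = 1" by (rule Q.emeasure_space_1)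
  finally show ?thesis
    by (intro integrableI_nonneg) (auto simp: h_nonneg)
qed

lemma integrable_Q_bounded:
  fixes g :: "real \<Rightarrow> real"
  assumes "g \<in> borel_measurable borel" "\<And>y. y \<in> {a..b} \<Longrightarrow> \<bar>g y\<bar> \<le> C"
  shows "integrable Q g"
  by (rule Q.integrable_const_bound[where B = C]) (use AE_Q assms in auto)

definition mean :: real where
  "mean = (\<integral>z. z \<partial>Q)"

lemma mean_pos: "0 < mean"
proof -
  have "a = (\<integral>z. a \<partial>Q)" by (simp add: Q.prob_space[simplified])
  also have "\<dots> \<le> mean" unfolding mean_def
    by (intro integral_mono_AE integrable_Q_bounded[where C = b] Q.integrable_const)
       (use AE_Q a_pos in auto)
  finally show ?thesis using a_pos by simp
qed

lemma h_uniformly_continuous: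
  assumes "0 < e"
  obtains \<rho> where "0 < \<rho>" "\<And>x y. \<bar>x - y\<bar> < \<rho> \<Longrightarrow> \<bar>h x - h y\<bar> < e"
proof -
  have "uniformly_continuous_on {a - 1..b + 1} h"
    by (intro compact_uniformly_continuous continuous_on_subset[OF h_continuous]) auto
  then obtain d where d: "0 < d"
    "\<And>x y. x \<in> {a - 1..b + 1} \<Longrightarrow> y \<in> {a - 1..b + 1} \<Longrightarrow> \<bar>x - y\<bar> < d \<Longrightarrow> \<bar>h x - h y\<bar> < e"
    using assms unfolding uniformly_continuous_on_def dist_real_def by metis
  have "\<bar>h x - h y\<bar> < e" if "\<bar>x - y\<bar> < min d 1" for x y
  proof (cases "x \<in> {a..b} \<or> y \<in> {a..b}")
    case True
    then have "x \<in> {a - 1..b + 1}" "y \<in> {a - 1..b + 1}" using that by auto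
    then show ?thesis using d that by auto
  next
    case False
    then show ?thesis using h_zero[of x] h_zero[of y] assms by auto
  qed
  then show thesis using d(1) that[of "min d 1"] by auto
qed

end

locale renewal_equation = step_density +
  fixes g :: "real \<Rightarrow> real" and C :: real
  assumes g_measurable[measurable]: "g \<in> borel_measurable borel"
    and g_bounded: "\<And>t. \<bar>g t\<bar> \<le> C"
    and renewal: "\<And>t. 0 \<le> t \<Longrightarrow> g t = (\<integral>y. g (t - y) \<partial>Q)"
begin

lemma C_nonneg: "0 \<le> C"
  using g_bounded[of 0] by linarith

text \<open>The renewal equation exhibits \<open>g\<close> on the half-line as a convolution of a bounded function with \<open>h\<close>,
  and so lends it the modulus of continuity of \<open>h\<close>, whatever the regularity of the boundary values.\<close>
lemma uniformly_continuous:
  assumes "0 < e"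
  obtains \<rho> where "0 < \<rho>"
    "\<And>s t. 0 \<le> s \<Longrightarrow> 0 \<le> t \<Longrightarrow> \<bar>s - t\<bar> < \<rho> \<Longrightarrow> \<bar>g s - g t\<bar> < e"
proof -
  define D where "D = C * (b - a + 2) + 1"
  have D: "0 < D" using C_nonneg a_less_b by (auto simp: D_def intro!: add_nonneg_pos)
  obtain r where r: "0 < r" "\<And>x y. \<bar>x - y\<bar> < r \<Longrightarrow> \<bar>h x - h y\<bar> < e / D"
    using h_uniformly_continuous[of "e / D"] assms D by auto
  have int: "integrable lborel (\<lambda>u. h (t - u) * g u)" for t
  proof -
    have "integrable lborel (\<lambda>u. h (t + (-1) * u))"
      by (rule lborel_integrable_real_affine) (use h_integrable in auto)
    then have "integrable lborel (\<lambda>u. C * h (t - u))" by simp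
    then show ?thesis
      by (rule Bochner_Integration.integrable_bound)
         (use C_nonneg h_nonneg g_bounded in
           \<open>auto intro!: AE_I2 mult_mono simp: abs_mult mult.commute\<close>)
  qed
  have conv: "g t = (\<integral>u. h (t - u) * g u \<partial>lborel)" if "0 \<le> t" for t
  proof -
    have "g t = (\<integral>y. h y * g (t - y) \<partial>lborel)"
      by (subst renewal[OF that]) (rule integral_Q, measurable)
    also have "\<dots> = (\<integral>u. h (t - u) * g u \<partial>lborel)"
      by (subst lborel_integral_real_affine[where c = "-1" and t = t]) auto
    finally show ?thesis .
  qed
  have "\<bar>g s - g t\<bar> < e" if st: "0 \<le> s" "0 \<le> t" "\<bar>s - t\<bar> < min r 1" for s t
  proof -
    let ?I = "{s - b - 1..s - a + 1}"
    have "g s - g t = (\<integral>u. (h (s - u) - h (t - u)) * g u \<partial>lborel)"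
      using int conv st by (simp add: left_diff_distrib)
    also have "\<bar>\<dots>\<bar> \<le> (\<integral>u. e / D * C * indicator ?I u \<partial>lborel)"
    proof (rule integral_abs_bound[THEN order_trans], rule integral_mono)
      show "integrable lborel (\<lambda>u. \<bar>(h (s - u) - h (t - u)) * g u\<bar>)"
        using int[of s] int[of t] by (auto simp: left_diff_distrib)
      show "\<bar>(h (s - u) - h (t - u)) * g u\<bar> \<le> e / D * C * indicator ?I u" for u
      proof (cases "u \<in> ?I")
        case True
        have "\<bar>h (s - u) - h (t - u)\<bar> \<le> e / D" using r(2)[of "s - u" "t - u"] st by auto
        then show ?thesis
          using True mult_mono[OF _ g_bounded[of u], of "\<bar>h (s - u) - h (t - u)\<bar>" "e / D"] assms D
          by (auto simp: abs_mult)
      next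
        case False
        then have "h (s - u) = 0" "h (t - u) = 0" using st by (auto intro!: h_zero)
        then show ?thesis using assms D C_nonneg by (simp add: indicator_def)
      qed
    qed (auto intro!: integrable_mult_right integrable_real_indicator
              simp: emeasure_lborel_Icc_eq)
    also have "\<dots> = e / D * (C * (b - a + 2))"
      using a_less_b by simp
    also have "\<dots> < e"
      using assms D by (simp add: D_def field_simps)
    finally show ?thesis .
  qed
  then show thesis using r(1) that[of "min r 1"] by auto
qed

text \<open>Up to the factor \<open>mean\<close>, this is the average of \<open>g\<close> over the past of \<open>t\<close>, seen from \<open>t\<close> under the
  stationary age law of the renewal process: by Fubini it equals
  \<open>\<integral> g (t - y) \<P>(Y \<ge> y) dy\<close> over \<open>y > 0\<close>. At \<open>t = 0\<close> it involves the boundary values only.\<close>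
definition conserved :: "real \<Rightarrow> real" where
  "conserved t = (\<integral>z. (\<integral>r. indicator {t - z..<t} r * g r \<partial>lborel) \<partial>Q)"

lemma integrable_interval: "integrable lborel (\<lambda>r. indicator {s..<t} r * g (r - z) :: real)"
  by (rule Bochner_Integration.integrable_bound[where f = "\<lambda>r. C * indicator {s..<t} r"])
     (use C_nonneg g_bounded integrable_bounded_indicator in \<open>auto simp: abs_mult split: split_indicator\<close>)

lemma integrable_interval_0: "integrable lborel (\<lambda>r. indicator {s..<t} r * g r :: real)"
  using integrable_interval[of s t 0] by simp

lemma integral_interval_bound:
  assumes "0 \<le> z"
  shows "\<bar>\<integral>r. indicator {t - z..<t} r * g r \<partial>lborel\<bar> \<le> C * z"
proof -
  have "\<bar>\<integral>r. indicator {t - z..<t} r * g r \<partial>lborel\<bar> \<le> (\<integral>r. C * indicator {t - z..<t} r \<partial>lborel)"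
    by (rule integral_abs_bound[THEN order_trans], rule integral_mono)
       (use integrable_abs[OF integrable_interval_0] g_bounded integrable_bounded_indicator
         in \<open>auto simp: abs_mult split: split_indicator\<close>)
  also have "\<dots> = C * z" using assms by simp
  finally show ?thesis .
qed

lemma interval_measurable[measurable]:
  "(\<lambda>z. \<integral>r. indicator {t - z..<t} r * g r \<partial>lborel) \<in> borel_measurable borel"
proof -
  have "(\<lambda>(z, r). (if t - z \<le> r \<and> r < t then g r else 0)) \<in> borel_measurable (borel \<Otimes>\<^sub>M lborel)"
    by measurable
  then have "(\<lambda>z. \<integral>r. (if t - z \<le> r \<and> r < t then g r else 0) \<partial>lborel) \<in> borel_measurable borel"
    by (rule lborel.borel_measurable_lebesgue_integral)
  then show ?thesis
    by (rule measurable_cong[THEN iffD1, rotated]) (auto intro!: Bochner_Integration.integral_cong simp: indicator_def)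
qed

lemma integrable_conserved: "integrable Q (\<lambda>z. \<integral>r. indicator {t - z..<t} r * g r \<partial>lborel)"
proof (rule integrable_Q_bounded)
  fix z assume "z \<in> {a..b}"
  then show "\<bar>\<integral>r. indicator {t - z..<t} r * g r \<partial>lborel\<bar> \<le> C * b"
    using integral_interval_bound[of z t] a_pos C_nonneg
    by (intro order_trans[OF integral_interval_bound] mult_left_mono) auto
qed measurable

text \<open>Shifting the window \<open>[t - z, t)\<close> from level 0 to level \<open>t\<close> changes the integral of \<open>g\<close> by
  \<open>\<integral> (g r - g (r - z)) dr\<close> over \<open>[0, t)\<close>. Integrated over \<open>z\<close>, the integrand vanishes by the renewal
  equation.\<close>
lemma conserved_const:
  assumes "0 \<le> t"
  shows "conserved t = conserved 0"
proof -
  let ?K = "\<lambda>z r. indicator {0..<t} r * (g r - g (r - z)) :: real"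
  interpret QL: pair_sigma_finite Q lborel ..
  have diff: "(\<integral>r. indicator {t - z..<t} r * g r \<partial>lborel) - (\<integral>r. indicator {0 - z..<0} r * g r \<partial>lborel)
      = (\<integral>r. ?K z r \<partial>lborel)" if "0 \<le> z" for z
  proof -
    have "(\<integral>r. indicator {0..<t} r * g (r - z) \<partial>lborel) = (\<integral>r. indicator {- z..<t - z} r * g r \<partial>lborel)"
      by (subst lborel_integral_real_affine[where c = 1 and t = z])
         (auto intro!: Bochner_Integration.integral_cong simp: indicator_def)
    moreover have "(\<integral>r. indicator {t - z..<t} r * g r \<partial>lborel) + (\<integral>r. indicator {- z..<t - z} r * g r \<partial>lborel)
      = (\<integral>r. indicator {- z..<0} r * g r \<partial>lborel) + (\<integral>r. indicator {0..<t} r * g r \<partial>lborel)"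
      unfolding Bochner_Integration.integral_add[OF integrable_interval_0 integrable_interval_0, symmetric]
      by (rule Bochner_Integration.integral_cong) (use assms that in \<open>auto simp: indicator_def\<close>)
    ultimately show ?thesis
      using integrable_interval_0[of 0 t] integrable_interval[of 0 t z]
      by (simp add: right_diff_distrib)
  qed
  have "conserved t - conserved 0 = (\<integral>z. (\<integral>r. ?K z r \<partial>lborel) \<partial>Q)"
    unfolding conserved_def Bochner_Integration.integral_diff[OF integrable_conserved integrable_conserved, symmetric]
  proof (rule integral_cong_AE)
    show "(\<lambda>z. \<integral>r. ?K z r \<partial>lborel) \<in> borel_measurable Q" by measurable
    show "AE z in Q. (\<integral>r. indicator {t - z..<t} r * g r \<partial>lborel) - (\<integral>r. indicator {0 - z..<0} r * g r \<partial>lborel)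
      = (\<integral>r. ?K z r \<partial>lborel)"
      using AE_Q by eventually_elim (rule diff, use a_pos in auto)
  qed measurable
  also have "\<dots> = (\<integral>r. (\<integral>z. ?K z r \<partial>Q) \<partial>lborel)"
  proof (rule QL.Fubini_integral[symmetric], rule Bochner_Integration.integrable_bound)
    have "integrable lborel (\<lambda>r. 2 * C * indicator {0..<t} r :: real)"
      by (intro integrable_mult_right integrable_bounded_indicator) auto
    then show "integrable (Q \<Otimes>\<^sub>M lborel) (\<lambda>(z, r). 2 * C * indicator {0..<t} r :: real)"
      by (intro QL.Fubini_integrable) (auto simp: case_prod_beta)
    show "AE x in Q \<Otimes>\<^sub>M lborel. norm (case x of (z, r) \<Rightarrow> ?K z r)
        \<le> norm (case x of (z, r) \<Rightarrow> 2 * C * indicator {0..<t} r)"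
    proof (rule AE_I2, clarify)
      fix z r
      have "\<bar>g r - g (r - z)\<bar> \<le> 2 * C" using g_bounded[of r] g_bounded[of "r - z"] by linarith
      then show "norm (?K z r) \<le> norm (2 * C * indicator {0..<t} r)"
        using C_nonneg by (auto simp: indicator_def)
    qed
  qed measurable
  also have "\<dots> = 0"
  proof (rule integral_eq_zero_AE, rule AE_I2)
    fix r
    show "(\<integral>z. ?K z r \<partial>Q) = 0"
    proof (cases "r \<in> {0..<t}")
      case True
      have "integrable Q (\<lambda>z. g (r - z))"
        by (rule integrable_Q_bounded[where C = C]) (use g_bounded in auto)
      then show ?thesis using True renewal[of r] by (simp add: Q.prob_space[simplified])
    qed simp
  qed
  finally show ?thesis by simp
qed

text \<open>Identifies a limit of \<open>g\<close> once it is known to hold on the whole past of the levels \<open>\<tau> n\<close>.\<close>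
lemma conserved_limit:
  assumes "\<And>y. 0 \<le> y \<Longrightarrow> (\<lambda>n. g (\<tau> n - y)) \<longlonglongrightarrow> l"
  shows "(\<lambda>n. conserved (\<tau> n)) \<longlonglongrightarrow> l * mean"
proof -
  have "(\<lambda>n. conserved (\<tau> n)) \<longlonglongrightarrow> (\<integral>z. l * z \<partial>Q)"
    unfolding conserved_def
  proof (rule integral_dominated_convergence[where w = "\<lambda>_. C * b"])
    show "AE z in Q. (\<lambda>n. \<integral>r. indicator {\<tau> n - z..<\<tau> n} r * g r \<partial>lborel) \<longlonglongrightarrow> l * z"
      using AE_Q
    proof eventually_elim
      fix z assume z: "z \<in> {a..b}"
      have "(\<lambda>n. \<integral>y. indicator {0<..z} y * g (\<tau> n - y) \<partial>lborel)
          \<longlonglongrightarrow> (\<integral>y. indicator {0<..z} y * l \<partial>lborel)"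
        by (rule integral_dominated_convergence[where w = "\<lambda>y. C * indicator {0<..z} y"])
           (use assms g_bounded integrable_bounded_indicator in
             \<open>auto simp: abs_mult split: split_indicator\<close>)
      moreover have "(\<integral>r. indicator {s - z..<s} r * g r \<partial>lborel)
          = (\<integral>y. indicator {0<..z} y * g (s - y) \<partial>lborel)" for s
        by (subst lborel_integral_real_affine[where c = "-1" and t = s])
           (auto intro!: Bochner_Integration.integral_cong simp: indicator_def)
      ultimately show "(\<lambda>n. \<integral>r. indicator {\<tau> n - z..<\<tau> n} r * g r \<partial>lborel) \<longlonglongrightarrow> l * z"
        using z a_pos by (simp add: mult.commute)
    qed
    show "AE z in Q. norm (\<integral>r. indicator {\<tau> n - z..<\<tau> n} r * g r \<partial>lborel) \<le> C * b" for n
      using AE_Q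
    proof eventually_elim
      fix z assume z: "z \<in> {a..b}"
      have "\<bar>\<integral>r. indicator {\<tau> n - z..<\<tau> n} r * g r \<partial>lborel\<bar> \<le> C * z"
        by (rule integral_interval_bound) (use z a_pos in auto)
      also have "\<dots> \<le> C * b" using z C_nonneg by (auto intro!: mult_left_mono)
      finally show "norm (\<integral>r. indicator {\<tau> n - z..<\<tau> n} r * g r \<partial>lborel) \<le> C * b" by simp
    qed
  qed auto
  then show ?thesis by (simp add: mean_def)
qed

text \<open>Let \<open>p > 0\<close> be the mass that the step law gives to a neighbourhood of \<open>z\<close>. If \<open>g\<close> were below
  \<open>l - e\<close> at infinitely many of the levels \<open>\<tau> n - (y + z)\<close>, uniform continuity would keep it below \<open>l - e / 2\<close> on the
  whole neighbourhood, and the average that equals \<open>g (\<tau> n - y)\<close> would fall short of \<open>l\<close> by about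
  \<open>p e / 2\<close>.\<close>
lemma limsup_attained_propagates:
  assumes \<tau>: "filterlim \<tau> at_top sequentially"
    and upper: "\<And>e. 0 < e \<Longrightarrow> \<forall>\<^sub>F t in at_top. g t < l + e"
    and y: "(\<lambda>n. g (\<tau> n - y)) \<longlonglongrightarrow> l"
    and z: "z \<in> {a..b}"
  shows "(\<lambda>n. g (\<tau> n - (y + z))) \<longlonglongrightarrow> l"
proof (rule ccontr)
  have lim: "filterlim (\<lambda>n. \<tau> n - c) at_top sequentially" for c
    using filterlim_tendsto_add_at_top[OF tendsto_const[of "- c"] \<tau>] by simp
  assume "\<not> ?thesis"
  then obtain e where e: "0 < e" "\<not> (\<forall>\<^sub>F n in sequentially. dist (g (\<tau> n - (y + z))) l < e)"
    unfolding tendsto_iff by blast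
  have "\<forall>\<^sub>F n in sequentially. g (\<tau> n - (y + z)) < l + e"
    using filterlim_iff[THEN iffD1, OF lim, rule_format, OF upper[OF e(1)]] .
  have low: "\<exists>\<^sub>F n in sequentially. g (\<tau> n - (y + z)) \<le> l - e"
    unfolding frequently_def
  proof (rule notI)
    assume "\<forall>\<^sub>F n in sequentially. \<not> g (\<tau> n - (y + z)) \<le> l - e"
    with \<open>\<forall>\<^sub>F n in sequentially. g (\<tau> n - (y + z)) < l + e\<close>
    have "\<forall>\<^sub>F n in sequentially. dist (g (\<tau> n - (y + z))) l < e"
      by eventually_elim (auto simp: dist_real_def)
    then show False using e(2) by contradiction
  qed
  obtain \<rho> where \<rho>: "0 < \<rho>"
    "\<And>s t. 0 \<le> s \<Longrightarrow> 0 \<le> t \<Longrightarrow> \<bar>s - t\<bar> < \<rho> \<Longrightarrow> \<bar>g s - g t\<bar> < e / 2"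
    using uniformly_continuous[of "e / 2"] e by auto
  let ?B = "{z - \<rho><..<z + \<rho>}"
  define p where "p = measure Q ?B"
  have p: "0 < p" "p \<le> 1"
    using h_support[OF z \<rho>(1)] by (auto simp: p_def Q_def[symmetric])
  \<comment> \<open>The upper margin \<open>d\<close> loses at most \<open>d\<close>, the neighbourhood gains \<open>p e / 2 = 2 d\<close>.\<close>
  define d where "d = p * e / 4"
  have d: "0 < d" using p e by (simp add: d_def)
  obtain t0 where t0: "\<And>t. t0 \<le> t \<Longrightarrow> g t < l + d"
    using upper[OF d] unfolding eventually_at_top_linorder by blast
  have "\<forall>\<^sub>F n in sequentially. max 0 t0 + \<bar>z\<bar> + \<rho> + b \<le> \<tau> n - y"
    using lim[of y] by (auto simp: filterlim_at_top)
  moreover have "\<forall>\<^sub>F n in sequentially. dist (g (\<tau> n - y)) l < d"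
    using y d by (auto simp: tendsto_iff)
  ultimately have "\<exists>\<^sub>F n in sequentially. max 0 t0 + \<bar>z\<bar> + \<rho> + b \<le> \<tau> n - y
      \<and> dist (g (\<tau> n - y)) l < d \<and> g (\<tau> n - (y + z)) \<le> l - e"
    using low by (elim frequently_rev_mp) (auto elim: eventually_elim2)
  then obtain n where n: "max 0 t0 + \<bar>z\<bar> + \<rho> + b \<le> \<tau> n - y"
      "dist (g (\<tau> n - y)) l < d" "g (\<tau> n - (y + z)) \<le> l - e"
    using frequently_ex by blast
  let ?s = "\<tau> n - y"
  have "g ?s = (\<integral>x. g (?s - x) \<partial>Q)" using n \<rho> a_pos a_less_b by (intro renewal) auto
  also have "\<dots> \<le> (\<integral>x. (l + d) - (d + e / 2) * indicator ?B x \<partial>Q)"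
  proof (rule integral_mono_AE)
    show "integrable Q (\<lambda>x. g (?s - x))"
      by (rule integrable_Q_bounded[where C = C]) (use g_bounded in auto)
    show "integrable Q (\<lambda>x. (l + d) - (d + e / 2) * indicator ?B x)"
      by (intro Bochner_Integration.integrable_diff Q.integrable_const integrable_mult_right integrable_real_indicator)
         (auto simp: Q.emeasure_eq_measure)
    show "AE x in Q. g (?s - x) \<le> (l + d) - (d + e / 2) * indicator ?B x"
      using AE_Q
    proof eventually_elim
      fix x assume x: "x \<in> {a..b}"
      show "g (?s - x) \<le> (l + d) - (d + e / 2) * indicator ?B x"
      proof (cases "x \<in> ?B")
        case True
        have "\<bar>g (?s - x) - g (?s - z)\<bar> < e / 2"
          using n x True z by (intro \<rho>(2)) auto
        then have "g (?s - x) - g (?s - z) < e / 2" by (rule order.strict_trans1[OF abs_ge_self])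
        moreover have "g (?s - z) \<le> l - e" using n(3) by (simp only: diff_diff_eq)
        ultimately have "g (?s - x) \<le> l - e / 2" by (simp only: field_simps)
        then show ?thesis using True by simp
      next
        case False
        moreover have "t0 \<le> ?s - x"
            using n(1) x \<rho>(1) max.cobounded2[of t0 0] abs_ge_zero[of z]
            unfolding atLeastAtMost_iff by linarith
          ultimately show ?thesis using t0[of "?s - x"] by simp
      qed
    qed
  qed
  also have "\<dots> = (l + d) - (d + e / 2) * p"
    by (subst Bochner_Integration.integral_diff)
       (auto simp: p_def Q.prob_space[simplified] Q.emeasure_eq_measure
         intro!: integrable_mult_right integrable_real_indicator)
  also have "\<dots> \<le> l - d"
    using p(1) e(1) by (simp add: d_def field_simps)
  finally show False using n(2) by (simp add: dist_real_def)
qed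

text \<open>The limit superior \<open>l\<close> of \<open>g\<close> is \<open>conserved 0 / mean\<close>: starting from levels along which \<open>g\<close> tends to
  \<open>l\<close>, repeated propagation reaches every sum of \<open>k\<close> equal steps, hence all of \<open>[k a, k b]\<close> for
  each \<open>k\<close>.\<close>
lemma eventually_below:
  assumes "0 < e"
  shows "\<forall>\<^sub>F t in at_top. g t < conserved 0 / mean + e"
proof -
  define S where "S s = Sup (g ` {s..})" for s :: real
  have bdd: "bdd_above (g ` {s..})" for s
    using g_bounded abs_le_D1 by (intro bdd_aboveI2[where M = C]) blast
  have S_ge: "g t \<le> S s" if "s \<le> t" for s t
    unfolding S_def using that by (intro cSup_upper bdd) auto
  have S_low: "- C \<le> S s" for s
    using S_ge[of s s] g_bounded[of s] by (simp add: abs_le_iff)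
  define l where "l = Inf (range S)"
  have bddS: "bdd_below (range S)" using S_low by (intro bdd_belowI2)
  have S_l: "l \<le> S s" for s unfolding l_def by (intro cInf_lower bddS) auto
  have upper: "\<forall>\<^sub>F t in at_top. g t < l + e" if "0 < e" for e
  proof -
    have "\<exists>s. S s < l + e"
      using cInf_lessD[of "range S" "l + e"] that by (auto simp: l_def)
    then obtain s where "S s < l + e" ..
    then show ?thesis using S_ge[of s] unfolding eventually_at_top_linorder
      by (intro exI[of _ s]) (meson order.strict_trans1)
  qed
  have "\<exists>t\<ge>real n. l - 1 / Suc n < g t" for n
  proof (rule ccontr)
    assume "\<not> ?thesis"
    then have "S (real n) \<le> l - 1 / Suc n"
      unfolding S_def by (intro cSup_least) (auto simp: not_less)
    moreover have "0 < 1 / real (Suc n)" by simp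
    ultimately show False using S_l[of "real n"] by linarith
  qed
  then obtain \<tau> where \<tau>: "\<And>n. real n \<le> \<tau> n" "\<And>n. l - 1 / Suc n < g (\<tau> n)" by metis
  have \<tau>_top: "filterlim \<tau> at_top sequentially"
    by (rule filterlim_at_top_mono[OF filterlim_real_sequentially]) (use \<tau> in auto)
  have start: "(\<lambda>n. g (\<tau> n)) \<longlonglongrightarrow> l"
  proof (rule order_tendstoI)
    fix c assume "c < l"
    have "(\<lambda>n. l - 1 / Suc n) \<longlonglongrightarrow> l - 0"
      by (intro tendsto_intros LIMSEQ_Suc lim_1_over_n)
    then have "\<forall>\<^sub>F n in sequentially. c < l - 1 / Suc n"
      using \<open>c < l\<close> by (intro order_tendstoD(1)) auto
    then show "\<forall>\<^sub>F n in sequentially. c < g (\<tau> n)"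
      by eventually_elim (use \<tau>(2) in \<open>auto intro: less_trans\<close>)
  next
    fix c assume "l < c"
    then have "\<forall>\<^sub>F t in at_top. g t < c" using upper[of "c - l"] by simp
    then show "\<forall>\<^sub>F n in sequentially. g (\<tau> n) < c"
      using filterlim_iff[THEN iffD1, OF \<tau>_top] by blast
  qed
  have multiple: "(\<lambda>n. g (\<tau> n - real j * z)) \<longlonglongrightarrow> l" if "z \<in> {a..b}" for j z
  proof (induction j)
    case 0 then show ?case using start by simp
  next
    case (Suc j)
    show ?case
      using limsup_attained_propagates[OF \<tau>_top upper Suc that] by (simp add: algebra_simps)
  qed
  \<comment> \<open>Consecutive intervals \<open>[k a, k b]\<close> and \<open>[(k + 1) a, (k + 1) b]\<close> overlap as soon as
      \<open>k (b - a) \<ge> a\<close>, so their union contains \<open>[c, \<infinity>)\<close>.\<close>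
  define c where "c = (a / (b - a) + 1) * a"
  have all: "(\<lambda>n. g ((\<tau> n - c) - y)) \<longlonglongrightarrow> l" if "0 \<le> y" for y
  proof -
    define k where "k = nat \<lfloor>(c + y) / a\<rfloor>"
    have cy: "0 \<le> c" using a_pos a_less_b by (simp add: c_def)
    have k: "real k \<le> (c + y) / a" "(c + y) / a < real k + 1"
      using cy that a_pos by (auto simp: k_def)
    have "a / (b - a) + 1 \<le> (c + y) / a"
      using that a_pos by (simp add: c_def field_simps)
    then have "a / (b - a) < real k" using k by linarith
    then have "a < real k * (b - a)" using a_less_b by (simp add: field_simps)
    moreover have "c + y < (real k + 1) * a" using k a_pos by (simp add: field_simps)
    ultimately have "c + y \<le> real k * b" by (simp add: algebra_simps)
    moreover have "real k * a \<le> c + y" using k a_pos by (simp add: field_simps)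
    moreover have k0: "0 < real k" using \<open>a / (b - a) < real k\<close> a_pos a_less_b
      by (intro le_less_trans[OF _ \<open>a / (b - a) < real k\<close>]) simp
    ultimately have "(c + y) / real k \<in> {a..b}" by (simp add: field_simps)
    from multiple[OF this, of k] k0 show ?thesis by (simp add: diff_diff_eq)
  qed
  have "(\<lambda>n. conserved (\<tau> n - c)) \<longlonglongrightarrow> l * mean"
    by (rule conserved_limit) (rule all)
  moreover have "\<forall>\<^sub>F n in sequentially. conserved (\<tau> n - c) = conserved 0"
  proof -
    have "\<forall>\<^sub>F n in sequentially. c \<le> \<tau> n" using \<tau>_top by (auto simp: filterlim_at_top)
    then show ?thesis by eventually_elim (rule conserved_const, simp)
  qed
  ultimately have "l * mean = conserved 0"
    by (rule LIMSEQ_unique[OF _ tendsto_eventually])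
  then have "l = conserved 0 / mean" using mean_pos by (simp add: field_simps)
  then show ?thesis using upper[OF assms] by simp
qed

theorem converges: "(g \<longlongrightarrow> conserved 0 / mean) at_top"
proof -
  interpret neg: renewal_equation h a b "\<lambda>t. - g t" C
    by unfold_locales (use g_bounded renewal in auto)
  have conserved_neg: "neg.conserved 0 = - conserved 0" by (simp add: neg.conserved_def conserved_def)
  show ?thesis
  proof (rule order_tendstoI)
    fix c assume "c < conserved 0 / mean"
    then show "\<forall>\<^sub>F t in at_top. c < g t"
      using neg.eventually_below[of "conserved 0 / mean - c"] by (simp add: conserved_neg)
  next
    fix c assume "conserved 0 / mean < c"
    then show "\<forall>\<^sub>F t in at_top. g t < c"
      using eventually_below[of "c - conserved 0 / mean"] by simp
  qed
qed

end

text \<open>The integral of \<open>\<phi>\<close> against the stationary overshoot law, in the form in which the conserved integral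
  produces it: \<open>\<phi> (- r)\<close> is the boundary value at the negative level \<open>r\<close>.\<close>
definition (in step_density) overshoot_mean :: "(real \<Rightarrow> real) \<Rightarrow> real" where
  "overshoot_mean \<phi> = (\<integral>z. (\<integral>r. indicator {- z..<0} r * \<phi> (- r) \<partial>lborel) \<partial>Q) / mean"

text \<open>The stationary overshoot has a density bounded by \<open>1 / mean\<close>, so small overshoots are unlikely.\<close>
lemma (in step_density) overshoot_mean_bound:
  assumes "0 \<le> e" "0 \<le> c" "0 \<le> \<delta>"
  shows "overshoot_mean (\<lambda>y. e + c * indicator {0<..\<delta>} y) \<le> e + c * \<delta> / mean"
proof -
  have inner: "(\<integral>r. indicator {- z..<0} r * (e + c * indicator {0<..\<delta>} (- r)) \<partial>lborel) \<le> e * z + c * \<delta>"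
    if "0 \<le> z" for z
  proof -
    have "(\<integral>r. indicator {- z..<0} r * (e + c * indicator {0<..\<delta>} (- r)) \<partial>lborel)
        \<le> (\<integral>r. e * indicator {- z..<0} r + c * indicator {- \<delta>..<0} r \<partial>lborel)"
      by (rule integral_mono')
         (use assms in \<open>auto intro!: Bochner_Integration.integrable_add integrable_mult_right
           integrable_bounded_indicator split: split_indicator\<close>)
    also have "\<dots> = e * z + c * \<delta>"
      using that assms by (subst Bochner_Integration.integral_add)
        (auto intro!: integrable_mult_right integrable_bounded_indicator)
    finally show ?thesis .
  qed
  have id: "integrable Q (\<lambda>z. z)"
    by (rule integrable_Q_bounded[where C = b]) (use a_pos in auto)
  have "(\<integral>z. (\<integral>r. indicator {- z..<0} r * (e + c * indicator {0<..\<delta>} (- r)) \<partial>lborel) \<partial>Q)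
      \<le> (\<integral>z. e * z + c * \<delta> \<partial>Q)"
  proof (rule integral_mono_AE')
    show "integrable Q (\<lambda>z. e * z + c * \<delta>)"
      using id by auto
    show "AE z in Q. (\<integral>r. indicator {- z..<0} r * (e + c * indicator {0<..\<delta>} (- r)) \<partial>lborel) \<le> e * z + c * \<delta>"
      using AE_Q by eventually_elim (rule inner, use a_pos in auto)
    show "AE z in Q. 0 \<le> e * z + c * \<delta>"
      using AE_Q by eventually_elim (use a_pos assms in auto)
  qed
  also have "\<dots> = e * mean + c * \<delta>"
    using id by (simp add: mean_def Q.prob_space[simplified])
  finally have "overshoot_mean (\<lambda>y. e + c * indicator {0<..\<delta>} y) \<le> (e * mean + c * \<delta>) / mean"
    unfolding overshoot_mean_def using mean_pos by (intro divide_right_mono) auto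
  also have "\<dots> = e + c * \<delta> / mean" using mean_pos by (simp add: field_simps)
  finally show ?thesis .
qed

section \<open>The genealogical tree\<close>

text \<open>Words carry their last letter first, so the descendants of the child \<open>[i]\<close> of the root are the words
  that end with \<open>i\<close>.\<close>
definition subtree :: "nat \<Rightarrow> (node \<Rightarrow> 'a) \<Rightarrow> node \<Rightarrow> 'a" where
  "subtree i x = (\<lambda>w. x (w @ [i]))"

locale iid_tree = prob_space \<nu> for \<nu> :: "'a measure"
begin

text \<open>The joint law of the labels, as a measure on labelled trees. All probabilistic arguments take place
  in this space, where subtrees are again points of the space.\<close>
definition P :: "(node \<Rightarrow> 'a) measure" where
  "P = PiM UNIV (\<lambda>_. \<nu>)"

sublocale P: prob_space P
  unfolding P_def by (intro prob_space_PiM prob_space_axioms)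

lemma measurable_node[measurable]: "(\<lambda>x. x u) \<in> P \<rightarrow>\<^sub>M \<nu>"
  unfolding P_def by measurable

lemma space_P: "x \<in> space P \<longleftrightarrow> (\<forall>u. x u \<in> space \<nu>)"
  by (auto simp: P_def space_PiM)

lemma measurable_into_P:
  assumes "\<And>u. (\<lambda>\<omega>. f \<omega> u) \<in> N \<rightarrow>\<^sub>M \<nu>"
  shows "f \<in> N \<rightarrow>\<^sub>M P"
proof -
  have "(\<lambda>\<omega> u. f \<omega> u) \<in> N \<rightarrow>\<^sub>M P"
    unfolding P_def
    by (rule measurable_PiM_single') (use assms in \<open>auto dest: measurable_space\<close>)
  then show ?thesis by simp
qed

lemma measurable_subtree[measurable]: "subtree i \<in> P \<rightarrow>\<^sub>M P"
  by (rule measurable_into_P) (simp add: subtree_def)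

lemma subtree_in_space: "x \<in> space P \<Longrightarrow> subtree i x \<in> space P"
  by (simp add: space_P subtree_def)

lemma distr_node: "distr P \<nu> (\<lambda>x. x u) = \<nu>"
  unfolding P_def by (rule distr_PiM_component) (auto intro: prob_space_axioms)

lemma AE_node: "AE s in \<nu>. R s \<Longrightarrow> AE x in P. \<forall>u. R (x u)"
  unfolding AE_all_countable P_def
  by (intro allI AE_PiM_component) (auto intro: prob_space_axioms)

lemma distr_subtree: "distr P P (subtree i) = P"
  using distr_PiM_reindex[of UNIV "\<lambda>_. \<nu>" "\<lambda>w. w @ [i]" UNIV]
  by (simp add: P_def subtree_def[abs_def] prob_space_axioms inj_on_def restrict_def)

lemma indep_nodes: "P.indep_vars (\<lambda>_. \<nu>) (\<lambda>u x. x u) UNIV"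
  unfolding P.indep_vars_iff_distr_eq_PiM[OF UNIV_not_empty measurable_node] distr_node
  by (simp add: P_def restrict_def distr_id2)

text \<open>The branching property for the root label and two subtrees. Two suffice, since only second moments of
  sums over the children have to be computed.\<close>
lemma distr_branching:
  assumes "i \<noteq> j"
  shows "distr P (\<nu> \<Otimes>\<^sub>M (P \<Otimes>\<^sub>M P)) (\<lambda>x. (x [], (subtree i x, subtree j x))) = \<nu> \<Otimes>\<^sub>M (P \<Otimes>\<^sub>M P)"
proof -
  let ?pi = "\<lambda>A. PiM A (\<lambda>_. \<nu>)" and ?r = "\<lambda>A x. restrict (\<lambda>u. x u) A"
  let ?S = "\<lambda>i. range (\<lambda>w. w @ [i])"
  have read: "(\<lambda>y w. y (w @ [k])) \<in> ?pi A \<rightarrow>\<^sub>M P" if "?S k \<subseteq> A" for k A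
    using that by (intro measurable_into_P measurable_component_singleton) auto
  have restr: "(\<lambda>w. ?r A x (w @ [k])) = subtree k x" if "?S k \<subseteq> A" for k A x
    using that by (auto simp: subtree_def fun_eq_iff image_subset_iff)
  have "P.indep_var (?pi (?S i)) (?r (?S i)) (?pi (?S j)) (?r (?S j))"
    using assms by (intro P.indep_var_restrict[OF indep_nodes]) auto
  from P.indep_var_compose[OF this read[OF order_refl] read[OF order_refl]]
  have "P.indep_var P (subtree i) P (subtree j)"
    by (simp add: comp_def restr subtree_def[abs_def])
  then have two: "distr P (P \<Otimes>\<^sub>M P) (\<lambda>x. (subtree i x, subtree j x)) = P \<Otimes>\<^sub>M P"
    by (simp add: P.indep_var_distribution_eq distr_subtree)
  let ?A = "{[]}" and ?B = "- {[]} :: node set"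
  let ?root = "\<lambda>y :: node \<Rightarrow> 'a. y []" and ?pair = "\<lambda>y :: node \<Rightarrow> 'a. (\<lambda>w. y (w @ [i]), \<lambda>w. y (w @ [j]))"
  have root[measurable]: "?root \<in> ?pi ?A \<rightarrow>\<^sub>M \<nu>" by (intro measurable_component_singleton) simp
  have pair[measurable]: "?pair \<in> ?pi ?B \<rightarrow>\<^sub>M P \<Otimes>\<^sub>M P" by (intro measurable_Pair read) auto
  have "P.indep_var (?pi ?A) (?r ?A) (?pi ?B) (?r ?B)"
    by (intro P.indep_var_restrict[OF indep_nodes]) auto
  then have r[measurable]: "?r ?A \<in> P \<rightarrow>\<^sub>M ?pi ?A" "?r ?B \<in> P \<rightarrow>\<^sub>M ?pi ?B"
    and split: "distr P (?pi ?A) (?r ?A) \<Otimes>\<^sub>M distr P (?pi ?B) (?r ?B)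
      = distr P (?pi ?A \<Otimes>\<^sub>M ?pi ?B) (\<lambda>x. (?r ?A x, ?r ?B x))"
    unfolding P.indep_var_distribution_eq by auto
  have dA: "distr (distr P (?pi ?A) (?r ?A)) \<nu> ?root = \<nu>"
    by (subst distr_distr) (auto simp: comp_def distr_node)
  have dB: "distr (distr P (?pi ?B) (?r ?B)) (P \<Otimes>\<^sub>M P) ?pair = P \<Otimes>\<^sub>M P"
    by (subst distr_distr) (auto simp: comp_def restr two[unfolded subtree_def[abs_def]])
  have "\<nu> \<Otimes>\<^sub>M (P \<Otimes>\<^sub>M P)
      = distr (distr P (?pi ?A) (?r ?A)) \<nu> ?root \<Otimes>\<^sub>M distr (distr P (?pi ?B) (?r ?B)) (P \<Otimes>\<^sub>M P) ?pair"
    by (simp only: dA dB)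
  also have "\<dots> = distr (distr P (?pi ?A) (?r ?A) \<Otimes>\<^sub>M distr P (?pi ?B) (?r ?B))
      (\<nu> \<Otimes>\<^sub>M (P \<Otimes>\<^sub>M P)) (\<lambda>(x, y). (?root x, ?pair y))"
  proof (rule pair_measure_distr)
    interpret PP: pair_prob_space P P ..
    show "sigma_finite_measure (distr (distr P (?pi ?B) (?r ?B)) (P \<Otimes>\<^sub>M P) ?pair)"
      unfolding dB by unfold_locales
  qed auto
  also have "\<dots> = distr P (\<nu> \<Otimes>\<^sub>M (P \<Otimes>\<^sub>M P)) (\<lambda>x. (x [], (subtree i x, subtree j x)))"
    unfolding split by (subst distr_distr) (auto simp: comp_def subtree_def[abs_def])
  finally show ?thesis by simp
qed

lemma integral_branching_pair:
  fixes F :: "'a \<Rightarrow> (node \<Rightarrow> 'a) \<Rightarrow> (node \<Rightarrow> 'a) \<Rightarrow> real"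
  assumes "i \<noteq> j"
    and [measurable]: "(\<lambda>(s, y, z). F s y z) \<in> borel_measurable (\<nu> \<Otimes>\<^sub>M (P \<Otimes>\<^sub>M P))"
    and bound: "\<And>s y z. s \<in> space \<nu> \<Longrightarrow> y \<in> space P \<Longrightarrow> z \<in> space P \<Longrightarrow> \<bar>F s y z\<bar> \<le> B"
  shows "(\<integral>x. F (x []) (subtree i x) (subtree j x) \<partial>P) = (\<integral>s. (\<integral>y. (\<integral>z. F s y z \<partial>P) \<partial>P) \<partial>\<nu>)"
proof -
  interpret PP: pair_prob_space P P ..
  interpret NPP: pair_prob_space \<nu> "P \<Otimes>\<^sub>M P" ..
  have "(\<integral>x. F (x []) (subtree i x) (subtree j x) \<partial>P)
      = (\<integral>q. (case q of (s, y, z) \<Rightarrow> F s y z) \<partial>(distr P (\<nu> \<Otimes>\<^sub>M (P \<Otimes>\<^sub>M P)) (\<lambda>x. (x [], (subtree i x, subtree j x)))))"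
    by (subst integral_distr) (auto simp: case_prod_beta)
  also have "\<dots> = (\<integral>q. (case q of (s, y, z) \<Rightarrow> F s y z) \<partial>(\<nu> \<Otimes>\<^sub>M (P \<Otimes>\<^sub>M P)))"
    by (simp add: distr_branching[OF \<open>i \<noteq> j\<close>])
  also have "\<dots> = (\<integral>s. (\<integral>q. (case q of (y, z) \<Rightarrow> F s y z) \<partial>(P \<Otimes>\<^sub>M P)) \<partial>\<nu>)"
    by (subst NPP.integral_fst'[symmetric])
       (auto intro!: NPP.P.integrable_const_bound[where B = B] AE_I2 bound simp: space_pair_measure)
  also have "\<dots> = (\<integral>s. (\<integral>y. (\<integral>z. F s y z \<partial>P) \<partial>P) \<partial>\<nu>)"
  proof (rule Bochner_Integration.integral_cong[OF refl])
    fix s assume s: "s \<in> space \<nu>"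
    have [measurable]: "(\<lambda>(y, z). F s y z) \<in> borel_measurable (P \<Otimes>\<^sub>M P)"
      using measurable_compose[OF measurable_Pair1'[OF s] assms(2)] by (simp add: case_prod_beta)
    show "(\<integral>q. (case q of (y, z) \<Rightarrow> F s y z) \<partial>(P \<Otimes>\<^sub>M P)) = (\<integral>y. (\<integral>z. F s y z \<partial>P) \<partial>P)"
      by (subst PP.integral_fst'[symmetric])
         (auto intro!: PP.P.integrable_const_bound[where B = B] AE_I2 bound s simp: space_pair_measure)
  qed
  finally show ?thesis .
qed

text \<open>The second subtree \<open>Suc i\<close> is a dummy that integrates out.\<close>
lemma integral_branching:
  fixes F :: "'a \<Rightarrow> (node \<Rightarrow> 'a) \<Rightarrow> real"
  assumes [measurable]: "(\<lambda>(s, y). F s y) \<in> borel_measurable (\<nu> \<Otimes>\<^sub>M P)"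
    and "\<And>s y. s \<in> space \<nu> \<Longrightarrow> y \<in> space P \<Longrightarrow> \<bar>F s y\<bar> \<le> B"
  shows "(\<integral>x. F (x []) (subtree i x) \<partial>P) = (\<integral>s. (\<integral>y. F s y \<partial>P) \<partial>\<nu>)"
  using integral_branching_pair[of i "Suc i" "\<lambda>s y z. F s y" B] assms
  by (simp add: P.prob_space)

end

text \<open>Transfers almost sure statements from the space of labelled trees to any family of labels.\<close>
lemma iid_family_distr:
  assumes "prob_space M" "iid_family M \<nu> X" "prob_space \<nu>"
  shows "(\<lambda>\<omega> u. X u \<omega>) \<in> M \<rightarrow>\<^sub>M iid_tree.P \<nu>"
    and "distr M (iid_tree.P \<nu>) (\<lambda>\<omega> u. X u \<omega>) = iid_tree.P \<nu>"
proof -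
  interpret M: prob_space M by fact
  interpret iid_tree \<nu> by (simp add: iid_tree_def assms(3))
  have indep: "M.indep_vars (\<lambda>_. \<nu>) X UNIV" and law: "distr M \<nu> (X u) = \<nu>" for u
    using assms(2) by (auto simp: iid_family_def)
  have rv: "M.random_variable \<nu> (X u)" for u
    using indep by (auto simp: M.indep_vars_def)
  show "(\<lambda>\<omega> u. X u \<omega>) \<in> M \<rightarrow>\<^sub>M P"
    by (rule measurable_into_P) (rule rv)
  show "distr M P (\<lambda>\<omega> u. X u \<omega>) = P"
    using M.indep_vars_iff_distr_eq_PiM[OF UNIV_not_empty rv, THEN iffD1, OF indep]
    by (simp add: law P_def restrict_def)
qed

section \<open>Almost sure convergence from summable second moments\<close>

lemma (in prob_space) AE_tendsto_zero_of_summable_second_moments: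
  fixes Z :: "nat \<Rightarrow> 'a \<Rightarrow> real"
  assumes [measurable]: "\<And>n. Z n \<in> borel_measurable M"
    and int: "\<And>n. integrable M (\<lambda>x. (Z n x)\<^sup>2)"
    and summable: "summable (\<lambda>n. \<integral>x. (Z n x)\<^sup>2 \<partial>M)"
  shows "AE x in M. (\<lambda>n. Z n x) \<longlonglongrightarrow> 0"
proof -
  have "(\<integral>\<^sup>+x. (\<Sum>n. ennreal ((Z n x)\<^sup>2)) \<partial>M) = (\<Sum>n. ennreal (\<integral>x. (Z n x)\<^sup>2 \<partial>M))"
    by (simp add: nn_integral_suminf nn_integral_eq_integral[OF int])
  also have "\<dots> = ennreal (\<Sum>n. \<integral>x. (Z n x)\<^sup>2 \<partial>M)"
    by (rule suminf_ennreal2) (auto simp: summable)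
  finally have "AE x in M. (\<Sum>n. ennreal ((Z n x)\<^sup>2)) \<noteq> \<infinity>"
    by (intro nn_integral_noteq_infinite) auto
  then show ?thesis
  proof eventually_elim
    fix x assume "(\<Sum>n. ennreal ((Z n x)\<^sup>2)) \<noteq> \<infinity>"
    then have "summable (\<lambda>n. (Z n x)\<^sup>2)"
      by (intro summable_suminf_not_top) auto
    then have "(\<lambda>n. sqrt ((Z n x)\<^sup>2)) \<longlonglongrightarrow> sqrt 0"
      by (intro tendsto_real_sqrt summable_LIMSEQ_zero)
    then show "(\<lambda>n. Z n x) \<longlonglongrightarrow> 0"
      by (simp add: tendsto_rabs_zero_iff)
  qed
qed

section \<open>Fragmentation sums along the tree\<close>

text \<open>The size-biasing identity is stated for bounded functions of either sign and in logarithmic scale. A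
  fragment of mass 0 has the default value \<open>ln 0 = 0\<close>, but then its weight \<open>s i\<close> removes the term.\<close>
locale fragmentation = step_density h a b
  for h :: "real \<Rightarrow> real" and a b :: real +
  fixes \<nu> :: "(nat \<Rightarrow> real) measure"
  assumes \<nu>_prob: "prob_space \<nu>"
    and sets_\<nu>: "sets \<nu> = sets ranked_masses_space"
    and AE_sum_1: "AE s in \<nu>. (\<Sum>i. s i) = 1"
    and AE_range: "AE s in \<nu>. \<forall>i. s i = 0 \<or> 0 < s i \<and> - ln (s i) \<in> {a..b}"
    and size_biased: "\<And>F B. F \<in> borel_measurable borel \<Longrightarrow> (\<And>y::real. \<bar>F y\<bar> \<le> (B::real)) \<Longrightarrow>
          (\<integral>s. (\<Sum>i. s i * F (- ln (s i))) \<partial>\<nu>) = (\<integral>y. F y \<partial>Q)"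
begin

sublocale iid_tree \<nu>
  by (simp add: iid_tree_def \<nu>_prob)

definition good :: "(nat \<Rightarrow> real) \<Rightarrow> bool" where
  "good s \<longleftrightarrow> s \<in> ranked_masses \<and> (\<Sum>i. s i) = 1 \<and>
     (\<forall>i. s i = 0 \<or> 0 < s i \<and> - ln (s i) \<in> {a..b})"

definition max_children :: nat where
  "max_children = nat \<lceil>exp b\<rceil>"

lemma space_\<nu>: "space \<nu> = ranked_masses"
  using sets_eq_imp_space_eq[OF sets_\<nu>] by (simp add: space_restrict_space space_PiM)

lemma measurable_mass[measurable]: "(\<lambda>s. s i) \<in> borel_measurable \<nu>"
  unfolding measurable_cong_sets[OF sets_\<nu> refl]
  by (intro measurable_restrict_space1) measurable

lemma measurable_tree_mass[measurable]: "(\<lambda>x. x u i) \<in> borel_measurable P"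
  using measurable_compose[OF measurable_node measurable_mass] .

lemma AE_good: "AE s in \<nu>. good s"
  using AE_sum_1 AE_range AE_space by eventually_elim (auto simp: good_def space_\<nu>)

lemma AE_tree_good: "AE x in P. \<forall>u. good (x u)"
  by (rule AE_node) (rule AE_good)

lemma ranked_nonneg: "s \<in> ranked_masses \<Longrightarrow> 0 \<le> s i"
  by (auto simp: ranked_masses_def)

lemma ranked_sum_le: "s \<in> ranked_masses \<Longrightarrow> (\<Sum>i<n. s i) \<le> 1"
  unfolding ranked_masses_def by (auto intro: order_trans[OF sum_le_suminf])

lemma good_ranked: "good s \<Longrightarrow> s \<in> ranked_masses"
  by (simp add: good_def)

lemma good_range: "good s \<Longrightarrow> s i \<noteq> 0 \<Longrightarrow> 0 < s i \<and> a \<le> - ln (s i) \<and> - ln (s i) \<le> b"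
  by (auto simp: good_def)

lemma good_le:
  assumes "good s"
  shows "s i \<le> exp (- a)"
proof (cases "s i = 0")
  case False
  then have "0 < s i" "ln (s i) \<le> - a" using good_range[OF assms, of i] by auto
  then show ?thesis by (metis exp_le_cancel_iff exp_ln)
qed simp

text \<open>The positive masses are at least \<open>exp (- b)\<close> and sum to at most 1.\<close>
lemma good_tail:
  assumes "good s" "max_children \<le> i"
  shows "s i = 0"
proof (rule ccontr)
  assume nz: "s i \<noteq> 0"
  have le: "exp (- b) \<le> s j" if "j \<le> i" for j
  proof -
    have "0 < s i" "- b \<le> ln (s i)" using good_range[OF assms(1) nz] by auto
    then have "exp (- b) \<le> s i" by (simp add: ln_ge_iff)
    also have "s i \<le> s j"
      using good_ranked[OF assms(1)] that by (auto simp: ranked_masses_def decseq_def)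
    finally show ?thesis .
  qed
  have "real (Suc i) * exp (- b) = (\<Sum>j<Suc i. exp (- b))" by simp
  also have "\<dots> \<le> (\<Sum>j<Suc i. s j)" by (intro sum_mono le) auto
  also have "\<dots> \<le> 1" by (rule ranked_sum_le[OF good_ranked[OF assms(1)]])
  finally have "real (Suc i) \<le> exp b" by (simp add: exp_minus field_simps)
  then show False using assms(2) unfolding max_children_def by linarith
qed

lemma good_suminf:
  assumes "good s"
  shows "(\<Sum>i. s i * v i) = (\<Sum>i<max_children. s i * v i)"
  by (rule suminf_finite) (use good_tail[OF assms] in \<open>auto simp: not_less\<close>)

lemma good_sum: "good s \<Longrightarrow> (\<Sum>i<max_children. s i) = 1"
  using good_suminf[of s "\<lambda>_. 1"] by (simp add: good_def)

lemma weighted_sum_bound: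
  assumes "s \<in> ranked_masses" "0 \<le> c" "\<And>i. i < max_children \<Longrightarrow> s i \<noteq> 0 \<Longrightarrow> \<bar>v i\<bar> \<le> c"
  shows "\<bar>\<Sum>i<max_children. s i * v i\<bar> \<le> c"
proof -
  have "\<bar>\<Sum>i<max_children. s i * v i\<bar> \<le> (\<Sum>i<max_children. s i * c)"
  proof (rule order_trans[OF sum_abs sum_mono])
    fix i assume "i \<in> {..<max_children}"
    then show "\<bar>s i * v i\<bar> \<le> s i * c"
      using ranked_nonneg[OF assms(1), of i] assms(3)[of i]
      by (cases "s i = 0") (auto simp: abs_mult intro!: mult_left_mono)
  qed
  also have "\<dots> = (\<Sum>i<max_children. s i) * c" by (simp add: sum_distrib_right)
  also have "\<dots> \<le> 1 * c" by (intro mult_right_mono ranked_sum_le assms)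
  finally show ?thesis by simp
qed

text \<open>The sum over the fragments stopped at level \<open>t\<close>, explored through at most \<open>n\<close> generations. The
  argument is \<open>\<phi>\<close> of the overshoot, a fragment of level \<open>t < 0\<close> having overshoot \<open>- t\<close>. The value after
  \<open>n\<close> generations is arbitrary, as every step lowers the level by at least \<open>a\<close>; the choice
  \<open>\<phi> (- t)\<close> makes every bound on \<open>\<phi>\<close> hold for the sum.\<close>
primrec stopped_sum_upto :: "(real \<Rightarrow> real) \<Rightarrow> nat \<Rightarrow> (node \<Rightarrow> nat \<Rightarrow> real) \<Rightarrow> real \<Rightarrow> real" where
  "stopped_sum_upto \<phi> 0 x t = \<phi> (- t)"
| "stopped_sum_upto \<phi> (Suc n) x t = (if t < 0 then \<phi> (- t)
     else \<Sum>i<max_children. x [] i * stopped_sum_upto \<phi> n (subtree i x) (t + ln (x [] i)))"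

definition stopped_sum :: "(real \<Rightarrow> real) \<Rightarrow> (node \<Rightarrow> nat \<Rightarrow> real) \<Rightarrow> real \<Rightarrow> real" where
  "stopped_sum \<phi> x t = stopped_sum_upto \<phi> (nat (\<lfloor>t / a\<rfloor> + 1)) x t"

abbreviation good_tree :: "(node \<Rightarrow> nat \<Rightarrow> real) \<Rightarrow> bool" where
  "good_tree x \<equiv> \<forall>u. good (x u)"

lemma good_tree_subtree: "good_tree x \<Longrightarrow> good_tree (subtree i x)"
  by (simp add: subtree_def)

lemma stopped_sum_upto_neg: "t < 0 \<Longrightarrow> stopped_sum_upto \<phi> n x t = \<phi> (- t)"
  by (cases n) auto

lemma child_level:
  "good s \<Longrightarrow> s i \<noteq> 0 \<Longrightarrow> t - b \<le> t + ln (s i) \<and> t + ln (s i) \<le> t - a"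
  using good_range[of s i] by auto

lemma stopped_sum_upto_stable:
  "good_tree x \<Longrightarrow> t < n * a \<Longrightarrow> t < m * a \<Longrightarrow> stopped_sum_upto \<phi> n x t = stopped_sum_upto \<phi> m x t"
proof (induction n arbitrary: m x t)
  case 0
  then show ?case by (simp add: stopped_sum_upto_neg)
next
  case (Suc n)
  show ?case
  proof (cases "t < 0")
    case True
    then show ?thesis by (simp add: stopped_sum_upto_neg)
  next
    case False
    then obtain m' where m: "m = Suc m'" using Suc.prems by (cases m) auto
    have "x [] i * stopped_sum_upto \<phi> n (subtree i x) (t + ln (x [] i))
        = x [] i * stopped_sum_upto \<phi> m' (subtree i x) (t + ln (x [] i))" for i
    proof (cases "x [] i = 0")
      case nz: False
      then have "t + ln (x [] i) \<le> t - a" using child_level Suc.prems(1) by blast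
      then show ?thesis
        using Suc.prems m by (subst Suc.IH[of "subtree i x" _ m'])
          (auto simp: good_tree_subtree algebra_simps)
    qed simp
    then have "(\<Sum>i<max_children. x [] i * stopped_sum_upto \<phi> n (subtree i x) (t + ln (x [] i)))
        = (\<Sum>i<max_children. x [] i * stopped_sum_upto \<phi> m' (subtree i x) (t + ln (x [] i)))"
      by (intro sum.cong refl)
    then show ?thesis using False m by simp
  qed
qed

lemma level_fuel: "t < real (nat (\<lfloor>t / a\<rfloor> + 1)) * a"
proof -
  have "t / a < real (nat (\<lfloor>t / a\<rfloor> + 1))" by linarith
  then show ?thesis using a_pos by (simp add: field_simps)
qed

lemma stopped_sum_eq_upto: "good_tree x \<Longrightarrow> t < n * a \<Longrightarrow> stopped_sum \<phi> x t = stopped_sum_upto \<phi> n x t"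
  unfolding stopped_sum_def by (intro stopped_sum_upto_stable level_fuel)

lemma stopped_sum_neg: "t < 0 \<Longrightarrow> stopped_sum \<phi> x t = \<phi> (- t)"
  by (simp add: stopped_sum_def stopped_sum_upto_neg)

lemma stopped_sum_step:
  assumes "good_tree x" "0 \<le> t"
  shows "stopped_sum \<phi> x t = (\<Sum>i<max_children. x [] i * stopped_sum \<phi> (subtree i x) (t + ln (x [] i)))"
proof -
  define n where "n = nat (\<lfloor>t / a\<rfloor> + 1)"
  have "t < real n * a" using level_fuel n_def by blast
  then have n: "t < real (Suc n) * a" using a_pos by (simp add: algebra_simps)
  have "x [] i * stopped_sum_upto \<phi> n (subtree i x) (t + ln (x [] i))
      = x [] i * stopped_sum \<phi> (subtree i x) (t + ln (x [] i))" for i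
  proof (cases "x [] i = 0")
    case False
    then have "t + ln (x [] i) \<le> t - a" using child_level assms(1) by blast
    also have "\<dots> < real n * a" using n by (simp add: algebra_simps)
    finally show ?thesis using assms(1)
      by (subst stopped_sum_eq_upto) (auto simp: good_tree_subtree)
  qed simp
  then have "(\<Sum>i<max_children. x [] i * stopped_sum_upto \<phi> n (subtree i x) (t + ln (x [] i)))
      = (\<Sum>i<max_children. x [] i * stopped_sum \<phi> (subtree i x) (t + ln (x [] i)))"
    by (intro sum.cong refl)
  then show ?thesis using stopped_sum_eq_upto[OF assms(1) n, of \<phi>] assms(2) by simp
qed

text \<open>By induction along the tree it suffices to compare the two levels at a fragment stopped at the lower
  one, with overshoot \<open>y\<close>. If \<open>y > r\<close>, it is also stopped at the higher level, with overshoot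
  \<open>y - r\<close>; otherwise both contributions are averages of values of \<open>\<phi>\<close> and differ by at most \<open>2 C\<close>.\<close>
lemma stopped_sum_interpolate:
  assumes "good_tree x" "0 \<le> r"
    and bound: "\<And>y. \<bar>\<phi> y\<bar> \<le> C"
    and late: "\<And>y. r < y \<Longrightarrow> \<bar>\<phi> (y - r) - \<phi> y\<bar> \<le> \<psi> y"
    and early: "\<And>y. 0 < y \<Longrightarrow> y \<le> r \<Longrightarrow> 2 * C \<le> \<psi> y"
    and stopped_sum_bound: "\<And>x t. good_tree x \<Longrightarrow> \<bar>stopped_sum \<phi> x t\<bar> \<le> C"
  shows "\<bar>stopped_sum \<phi> x (t + r) - stopped_sum \<phi> x t\<bar> \<le> stopped_sum \<psi> x t"
proof -
  have "t < real n * a \<Longrightarrow> good_tree x \<Longrightarrow> \<bar>stopped_sum \<phi> x (t + r) - stopped_sum \<phi> x t\<bar> \<le> stopped_sum \<psi> x t" for n x t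
  proof (induction n arbitrary: x t)
    case (Suc n)
    show ?case
    proof (cases "t < 0")
      case neg: True
      show ?thesis
      proof (cases "t + r < 0")
        case True
        then show ?thesis using neg late[of "- t"] by (simp add: stopped_sum_neg)
      next
        case False
        have "\<bar>stopped_sum \<phi> x (t + r) - stopped_sum \<phi> x t\<bar> \<le> 2 * C"
          using stopped_sum_bound[OF Suc.prems(2), of "t + r"] stopped_sum_bound[OF Suc.prems(2), of t] by linarith
        then show ?thesis using neg False early[of "- t"] by (simp add: stopped_sum_neg)
      qed
    next
      case False
      let ?c = "\<lambda>i. t + ln (x [] i)"
      have diff: "stopped_sum \<phi> x (t + r) - stopped_sum \<phi> x t
          = (\<Sum>i<max_children. x [] i * (stopped_sum \<phi> (subtree i x) (?c i + r) - stopped_sum \<phi> (subtree i x) (?c i)))"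
        using False assms(2) stopped_sum_step[OF Suc.prems(2), of t] stopped_sum_step[OF Suc.prems(2), of "t + r"]
        by (simp add: sum_subtractf right_diff_distrib add_ac)
      have "\<bar>stopped_sum \<phi> x (t + r) - stopped_sum \<phi> x t\<bar> \<le> (\<Sum>i<max_children. x [] i * stopped_sum \<psi> (subtree i x) (?c i))"
        unfolding diff
      proof (rule order_trans[OF sum_abs sum_mono])
        fix i
        have nonneg: "0 \<le> x [] i" using Suc.prems(2) good_ranked ranked_nonneg by blast
        show "\<bar>x [] i * (stopped_sum \<phi> (subtree i x) (?c i + r) - stopped_sum \<phi> (subtree i x) (?c i))\<bar>
            \<le> x [] i * stopped_sum \<psi> (subtree i x) (?c i)"
        proof (cases "x [] i = 0")
          case nz: False
          have "?c i \<le> t - a" using child_level[of "x []" i t] nz Suc.prems(2) by blast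
          then have "?c i < real n * a" using Suc.prems(1) by (simp add: algebra_simps)
          from Suc.IH[OF this good_tree_subtree[OF Suc.prems(2)]] nonneg
          show ?thesis by (auto simp: abs_mult intro!: mult_left_mono)
        qed simp
      qed
      also have "\<dots> = stopped_sum \<psi> x t" using False by (intro stopped_sum_step[OF Suc.prems(2), symmetric]) simp
      finally show ?thesis .
    qed
  next
    case 0
    show ?case
    proof (cases "t + r < 0")
      case True
      then show ?thesis using 0 assms(2) late[of "- t"] by (simp add: stopped_sum_neg)
    next
      case False
      have "\<bar>stopped_sum \<phi> x (t + r) - stopped_sum \<phi> x t\<bar> \<le> 2 * C"
        using stopped_sum_bound[OF 0(2), of "t + r"] stopped_sum_bound[OF 0(2), of t] by linarith
      then show ?thesis using 0 False early[of "- t"] by (simp add: stopped_sum_neg)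
    qed
  qed
  then show ?thesis using level_fuel assms(1) by blast
qed

end

section \<open>Mean and fluctuations of a stopped sum\<close>

locale fragmentation_functional = fragmentation +
  fixes \<phi> :: "real \<Rightarrow> real" and C :: real
  assumes \<phi>_measurable[measurable]: "\<phi> \<in> borel_measurable borel"
    and \<phi>_bounded: "\<And>y. \<bar>\<phi> y\<bar> \<le> C"
begin

lemma C_nonneg: "0 \<le> C"
  using \<phi>_bounded[of 0] by linarith

lemma stopped_sum_upto_measurable[measurable]:
  "(\<lambda>(x, t). stopped_sum_upto \<phi> n x t) \<in> borel_measurable (P \<Otimes>\<^sub>M borel)"
proof (induction n)
  case (Suc n)
  note [measurable] = Suc
  have "(\<lambda>(x, t). stopped_sum_upto \<phi> n (subtree i x) (t + ln (x [] i))) \<in> borel_measurable (P \<Otimes>\<^sub>M borel)" for i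
    by measurable
  then show ?case by (simp add: case_prod_beta) measurable
qed simp

lemma stopped_sum_measurable: "(\<lambda>q. stopped_sum \<phi> (fst q) (snd q)) \<in> borel_measurable (P \<Otimes>\<^sub>M borel)"
  unfolding stopped_sum_def
  by (rule measurable_compose_countable[where f = "\<lambda>n q. stopped_sum_upto \<phi> n (fst q) (snd q)"]) 
     (use stopped_sum_upto_measurable in \<open>auto simp: case_prod_beta\<close>)

lemma stopped_sum_measurable_comp[measurable]:
  assumes [measurable]: "u \<in> K \<rightarrow>\<^sub>M P" "v \<in> borel_measurable K"
  shows "(\<lambda>q. stopped_sum \<phi> (u q) (v q)) \<in> borel_measurable K"
  using measurable_compose[OF measurable_Pair[OF assms] stopped_sum_measurable] by simp

lemma stopped_sum_upto_bounded: "x \<in> space P \<Longrightarrow> \<bar>stopped_sum_upto \<phi> n x t\<bar> \<le> C"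
proof (induction n arbitrary: x t)
  case (Suc n)
  have "x [] \<in> ranked_masses" using Suc.prems by (simp add: space_P space_\<nu>)
  then show ?case
    using Suc \<phi>_bounded by (auto intro!: weighted_sum_bound C_nonneg subtree_in_space)
qed (simp add: \<phi>_bounded)

lemma stopped_sum_bounded: "x \<in> space P \<Longrightarrow> \<bar>stopped_sum \<phi> x t\<bar> \<le> C"
  unfolding stopped_sum_def by (rule stopped_sum_upto_bounded)

lemma good_tree_in_space: "good_tree x \<Longrightarrow> x \<in> space P"
  using good_ranked by (auto simp: space_P space_\<nu>)

definition mean_sum :: "real \<Rightarrow> real" where
  "mean_sum t = (\<integral>x. stopped_sum \<phi> x t \<partial>P)"

lemma mean_sum_measurable[measurable]: "mean_sum \<in> borel_measurable borel"
  unfolding mean_sum_def by measurable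

lemma mean_sum_bounded: "\<bar>mean_sum t\<bar> \<le> C"
proof -
  have "\<bar>mean_sum t\<bar> \<le> (\<integral>x. \<bar>stopped_sum \<phi> x t\<bar> \<partial>P)" unfolding mean_sum_def by (rule integral_abs_bound)
  also have "\<dots> \<le> C"
    by (rule P.integral_le_const) (auto intro!: P.integrable_const_bound[where B = C] AE_I2 stopped_sum_bounded)
  finally show ?thesis .
qed

lemma mean_sum_neg: "t < 0 \<Longrightarrow> mean_sum t = \<phi> (- t)"
  by (simp add: mean_sum_def stopped_sum_neg P.prob_space)

lemma mass_bound: "s \<in> space \<nu> \<Longrightarrow> \<bar>s i\<bar> \<le> 1"
  using ranked_nonneg[of s] ranked_sum_le[of s "Suc i"] sum_nonneg[of "{..<i}" s]
  by (auto simp: space_\<nu>)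

lemma mass_mult_bound: "s \<in> space \<nu> \<Longrightarrow> \<bar>v\<bar> \<le> B \<Longrightarrow> \<bar>s i * v\<bar> \<le> B"
  using mult_mono[of "\<bar>s i\<bar>" 1 "\<bar>v\<bar>" B] mass_bound[of s i] by (auto simp: abs_mult)

lemma integrable_mass_square: "integrable \<nu> (\<lambda>s. s i * s i * B)"
proof (intro integrable_mult_left integrable_const_bound[where B = 1] AE_I2)
  fix s assume "s \<in> space \<nu>"
  then show "norm (s i * s i) \<le> 1"
    unfolding real_norm_def by (intro mass_mult_bound mass_bound)
qed measurable

text \<open>The many-to-one formula over one generation.\<close>
lemma integral_weighted_children:
  assumes [measurable]: "(\<lambda>q. W (fst q) (snd q)) \<in> borel_measurable (P \<Otimes>\<^sub>M borel)"
    and bound: "\<And>x t. x \<in> space P \<Longrightarrow> \<bar>W x t\<bar> \<le> B"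
  shows "(\<integral>x. (\<Sum>i<max_children. x [] i * W (subtree i x) (t + ln (x [] i))) \<partial>P)
      = (\<Sum>i<max_children. \<integral>s. s i * (\<integral>y. W y (t + ln (s i)) \<partial>P) \<partial>\<nu>)"
proof -
  have comp[measurable]: "(\<lambda>q. W (u q) (v q)) \<in> borel_measurable K"
    if [measurable]: "u \<in> K \<rightarrow>\<^sub>M P" "v \<in> borel_measurable K" for u v and K :: "'z measure"
    using measurable_compose[OF measurable_Pair[OF that] assms(1)] by simp
  have "(\<integral>x. (\<Sum>i<max_children. x [] i * W (subtree i x) (t + ln (x [] i))) \<partial>P)
      = (\<Sum>i<max_children. \<integral>x. x [] i * W (subtree i x) (t + ln (x [] i)) \<partial>P)"
    by (rule Bochner_Integration.integral_sum, rule P.integrable_const_bound[where B = B])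
       (auto intro!: AE_I2 mass_mult_bound bound subtree_in_space simp: space_P)
  also have "\<dots> = (\<Sum>i<max_children. \<integral>s. s i * (\<integral>y. W y (t + ln (s i)) \<partial>P) \<partial>\<nu>)"
  proof (rule sum.cong[OF refl])
    fix i
    show "(\<integral>x. x [] i * W (subtree i x) (t + ln (x [] i)) \<partial>P)
        = (\<integral>s. s i * (\<integral>y. W y (t + ln (s i)) \<partial>P) \<partial>\<nu>)"
      by (subst integral_branching[where F = "\<lambda>s y. s i * W y (t + ln (s i))" and B = B])
         (auto intro!: mass_mult_bound bound)
  qed
  finally show ?thesis .
qed

text \<open>Conditioning on the first generation, the branching property turns the expectation into a size-biased
  sum over the children of the root, which is an integral against the step law.\<close>
lemma mean_sum_renewal:
  assumes "0 \<le> t"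
  shows "mean_sum t = (\<integral>y. mean_sum (t - y) \<partial>Q)"
proof -
  have "mean_sum t = (\<integral>x. (\<Sum>i<max_children. x [] i * stopped_sum \<phi> (subtree i x) (t + ln (x [] i))) \<partial>P)"
    unfolding mean_sum_def
    by (rule integral_cong_AE) (use AE_tree_good stopped_sum_step[OF _ assms] in auto)
  also have "\<dots> = (\<Sum>i<max_children. \<integral>s. s i * (\<integral>y. stopped_sum \<phi> y (t + ln (s i)) \<partial>P) \<partial>\<nu>)"
    by (rule integral_weighted_children[where B = C]) (auto intro: stopped_sum_bounded)
  also have "\<dots> = (\<Sum>i<max_children. \<integral>s. s i * mean_sum (t + ln (s i)) \<partial>\<nu>)"
    by (simp add: mean_sum_def)
  also have "\<dots> = (\<integral>s. (\<Sum>i<max_children. s i * mean_sum (t + ln (s i))) \<partial>\<nu>)"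
    by (rule Bochner_Integration.integral_sum[symmetric], rule integrable_const_bound[where B = C])
       (auto intro!: AE_I2 mass_mult_bound mean_sum_bounded)
  also have "\<dots> = (\<integral>s. (\<Sum>i. s i * mean_sum (t - (- ln (s i)))) \<partial>\<nu>)"
    by (rule integral_cong_AE) (use AE_good in \<open>auto simp: good_suminf\<close>)
  also have "\<dots> = (\<integral>y. mean_sum (t - y) \<partial>Q)"
    by (rule size_biased[where B = C]) (auto intro: mean_sum_bounded)
  finally show ?thesis .
qed

sublocale renewal: renewal_equation h a b mean_sum C
  by unfold_locales (auto intro: mean_sum_bounded mean_sum_renewal)

lemma mean_sum_limit: "(mean_sum \<longlongrightarrow> overshoot_mean \<phi>) at_top"
proof -
  have "renewal.conserved 0 = (\<integral>z. (\<integral>r. indicator {- z..<0} r * \<phi> (- r) \<partial>lborel) \<partial>Q)"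
    unfolding renewal.conserved_def
    by (intro Bochner_Integration.integral_cong refl) (auto simp: mean_sum_neg split: split_indicator)
  then show ?thesis using renewal.converges by (simp add: overshoot_mean_def)
qed

text \<open>The conditional expectation of the stopped sum given the first \<open>k\<close> generations, provided that no
  fragment stops before generation \<open>k\<close>; this holds when \<open>t \<ge> k b\<close>.\<close>
primrec cond_sum :: "nat \<Rightarrow> (node \<Rightarrow> nat \<Rightarrow> real) \<Rightarrow> real \<Rightarrow> real" where
  "cond_sum 0 x t = mean_sum t"
| "cond_sum (Suc k) x t = (\<Sum>i<max_children. x [] i * cond_sum k (subtree i x) (t + ln (x [] i)))"

definition deviation :: "nat \<Rightarrow> (node \<Rightarrow> nat \<Rightarrow> real) \<Rightarrow> real \<Rightarrow> real" where
  "deviation k x t = stopped_sum \<phi> x t - cond_sum k x t"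

lemma cond_sum_measurable: "(\<lambda>q. cond_sum k (fst q) (snd q)) \<in> borel_measurable (P \<Otimes>\<^sub>M borel)"
proof (induction k)
  case (Suc k)
  have [measurable]: "(\<lambda>q. cond_sum k (u q) (v q)) \<in> borel_measurable K"
    if "u \<in> K \<rightarrow>\<^sub>M P" "v \<in> borel_measurable K" for u v and K :: "'z measure"
    using measurable_compose[OF measurable_Pair[OF that] Suc] by simp
  show ?case by simp
qed simp

lemma deviation_measurable[measurable]: "(\<lambda>q. deviation k (fst q) (snd q)) \<in> borel_measurable (P \<Otimes>\<^sub>M borel)"
  unfolding deviation_def using cond_sum_measurable by measurable

lemma deviation_measurable_comp[measurable]:
  assumes [measurable]: "u \<in> K \<rightarrow>\<^sub>M P" "v \<in> borel_measurable K"
  shows "(\<lambda>q. deviation k (u q) (v q)) \<in> borel_measurable K"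
  using measurable_compose[OF measurable_Pair[OF assms] deviation_measurable] by simp

lemma cond_sum_bounded: "x \<in> space P \<Longrightarrow> \<bar>cond_sum k x t\<bar> \<le> C"
proof (induction k arbitrary: x t)
  case (Suc k)
  have "x [] \<in> ranked_masses" using Suc.prems by (simp add: space_P space_\<nu>)
  then show ?case
    using Suc by (auto intro!: weighted_sum_bound C_nonneg subtree_in_space)
qed (simp add: mean_sum_bounded)

lemma deviation_bounded: "x \<in> space P \<Longrightarrow> \<bar>deviation k x t\<bar> \<le> 2 * C"
  unfolding deviation_def using stopped_sum_bounded[of x t] cond_sum_bounded[of x k t] by linarith

lemma deviation_square_bounded: "x \<in> space P \<Longrightarrow> (deviation k x t)\<^sup>2 \<le> (2 * C)\<^sup>2"
  using power_mono[OF deviation_bounded[of x k t] abs_ge_zero, of 2] by (simp only: power2_abs)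

lemma deviation_square_integrable: "integrable P (\<lambda>x. (deviation k x t)\<^sup>2)"
  by (rule P.integrable_const_bound[where B = "(2 * C)\<^sup>2"])
     (use deviation_square_bounded in \<open>auto intro!: AE_I2\<close>)

lemma deviation_step:
  assumes "good_tree x" "0 \<le> t"
  shows "deviation (Suc k) x t = (\<Sum>i<max_children. x [] i * deviation k (subtree i x) (t + ln (x [] i)))"
  by (simp add: deviation_def stopped_sum_step[OF assms] sum_subtractf[symmetric] right_diff_distrib)

lemma child_level_ge:
  assumes "good s" "s i \<noteq> 0" "real (Suc k) * b \<le> t"
  shows "real k * b \<le> t + ln (s i)"
  using child_level[OF assms(1,2), of t] assms(3) by (simp add: algebra_simps)

lemma level_nonneg: "real k * b \<le> t \<Longrightarrow> 0 \<le> t"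
  using a_pos a_less_b by (smt (verit) mult_nonneg_nonneg of_nat_0_le_iff)

lemma deviation_mean: "real k * b \<le> t \<Longrightarrow> (\<integral>x. deviation k x t \<partial>P) = 0"
proof (induction k arbitrary: t)
  case 0
  have "integrable P (\<lambda>x. stopped_sum \<phi> x t)"
    by (auto intro!: P.integrable_const_bound[where B = C] AE_I2 stopped_sum_bounded)
  then show ?case by (simp add: deviation_def mean_sum_def P.prob_space)
next
  case (Suc k)
  have "(\<integral>x. deviation (Suc k) x t \<partial>P) = (\<integral>x. (\<Sum>i<max_children. x [] i * deviation k (subtree i x) (t + ln (x [] i))) \<partial>P)"
    by (rule integral_cong_AE) (use AE_tree_good deviation_step level_nonneg[OF Suc.prems] in auto)
  also have "\<dots> = (\<Sum>i<max_children. \<integral>s. s i * (\<integral>y. deviation k y (t + ln (s i)) \<partial>P) \<partial>\<nu>)"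
    by (rule integral_weighted_children[where B = "2 * C"]) (auto intro: deviation_bounded)
  also have "\<dots> = (\<Sum>i<max_children. \<integral>s. 0 \<partial>\<nu>)"
  proof (intro sum.cong refl integral_cong_AE)
    fix i
    show "AE s in \<nu>. s i * (\<integral>y. deviation k y (t + ln (s i)) \<partial>P) = 0"
      using AE_good by eventually_elim (use Suc.IH child_level_ge[OF _ _ Suc.prems] in auto)
  qed measurable
  finally show ?case by simp
qed

text \<open>Expand the square of \<open>\<Sum>\<^sub>i s\<^sub>i D\<^sub>i\<close>, where \<open>D\<^sub>i\<close> is the deviation in the subtree of the child
  \<open>i\<close>. Deviations in different subtrees are centred and independent given the root, so only
  \<open>\<Sum>\<^sub>i s\<^sub>i\<^sup>2 D\<^sub>i\<^sup>2\<close> contributes, and \<open>\<Sum>\<^sub>i s\<^sub>i\<^sup>2 \<le> exp (- a) \<Sum>\<^sub>i s\<^sub>i = exp (- a)\<close>. Each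
  generation thus gains a factor \<open>exp (- a)\<close>.\<close>
lemma deviation_second_moment: "real k * b \<le> t \<Longrightarrow> (\<integral>x. (deviation k x t)\<^sup>2 \<partial>P) \<le> (2 * C)\<^sup>2 * exp (- a * real k)"
proof (induction k arbitrary: t)
  case 0
  have "(\<integral>x. (deviation 0 x t)\<^sup>2 \<partial>P) \<le> (2 * C)\<^sup>2"
    by (intro P.integral_le_const deviation_square_integrable AE_I2 deviation_square_bounded)
  then show ?case by simp
next
  case (Suc k)
  define B where "B = (2 * C)\<^sup>2 * exp (- a * real k)"
  let ?c = "\<lambda>s i. t + ln (s i)"
  define E where "E i j = (\<integral>x. (x [] i * deviation k (subtree i x) (?c (x []) i))
      * (x [] j * deviation k (subtree j x) (?c (x []) j)) \<partial>P)" for i j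
  define D where "D = (2 * C) * (2 * C)"
  have prod_bound: "\<bar>(s i * deviation k y u) * (s j * deviation k z v)\<bar> \<le> D"
    if "s \<in> space \<nu>" "y \<in> space P" "z \<in> space P" for s i j y z u v
    unfolding abs_mult[of "s i * deviation k y u"] D_def using that C_nonneg
    by (intro mult_mono mass_mult_bound deviation_bounded) auto
  have square_bound: "(s i * deviation k y u) * (s i * deviation k y u) \<le> D"
    if "s \<in> space \<nu>" "y \<in> space P" for s i y u
    using prod_bound[OF that(1) that(2) that(2)] by (rule order_trans[OF abs_ge_self])
  have off: "E i j = 0" if "i \<noteq> j" for i j
  proof -
    have "E i j = (\<integral>s. (\<integral>y. (\<integral>z. (s i * deviation k y (?c s i)) * (s j * deviation k z (?c s j)) \<partial>P) \<partial>P) \<partial>\<nu>)"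
      unfolding E_def by (rule integral_branching_pair[OF that, where B = D])
        (auto simp: case_prod_beta intro!: prod_bound)
    also have "\<dots> = (\<integral>s. 0 \<partial>\<nu>)"
    proof (rule integral_cong_AE)
      show "AE s in \<nu>. (\<integral>y. (\<integral>z. (s i * deviation k y (?c s i)) * (s j * deviation k z (?c s j)) \<partial>P) \<partial>P) = 0"
        using AE_good
      proof eventually_elim
        fix s assume s: "good s"
        show "(\<integral>y. (\<integral>z. (s i * deviation k y (?c s i)) * (s j * deviation k z (?c s j)) \<partial>P) \<partial>P) = 0"
          using deviation_mean child_level_ge[OF s _ Suc.prems, of j] by (cases "s j = 0") auto
      qed
    qed measurable
    finally show ?thesis by simp
  qed
  have diag: "E i i \<le> (\<integral>s. s i * s i * B \<partial>\<nu>)" for i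
  proof -
    have "E i i = (\<integral>s. (\<integral>y. (s i * deviation k y (?c s i)) * (s i * deviation k y (?c s i)) \<partial>P) \<partial>\<nu>)"
      unfolding E_def
      by (rule integral_branching[where F = "\<lambda>s y. (s i * deviation k y (?c s i)) * (s i * deviation k y (?c s i))" and B = D])
        (auto simp: case_prod_beta intro!: square_bound)
    also have "\<dots> \<le> (\<integral>s. s i * s i * B \<partial>\<nu>)"
    proof (rule integral_mono_AE)
      have "\<bar>\<integral>y. (s i * deviation k y (?c s i)) * (s i * deviation k y (?c s i)) \<partial>P\<bar> \<le> D"
        if "s \<in> space \<nu>" for s
        using that by (intro order_trans[OF integral_abs_bound] P.integral_le_const)
          (auto intro!: AE_I2 square_bound P.integrable_const_bound[where B = D])
      then show "integrable \<nu> (\<lambda>s. \<integral>y. (s i * deviation k y (?c s i)) * (s i * deviation k y (?c s i)) \<partial>P)"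
        by (intro integrable_const_bound[where B = D] AE_I2) auto
      show "integrable \<nu> (\<lambda>s. s i * s i * B)"
        by (rule integrable_mass_square)
      show "AE s in \<nu>. (\<integral>y. (s i * deviation k y (?c s i)) * (s i * deviation k y (?c s i)) \<partial>P) \<le> s i * s i * B"
        using AE_good
      proof eventually_elim
        fix s assume s: "good s"
        have "(\<integral>y. (s i * deviation k y (?c s i)) * (s i * deviation k y (?c s i)) \<partial>P)
            = s i * s i * (\<integral>y. (deviation k y (?c s i))\<^sup>2 \<partial>P)"
          by (simp add: power2_eq_square mult_ac flip: integral_mult_right_zero)
        also have "\<dots> \<le> s i * s i * B"
        proof (cases "s i = 0")
          case False
          then show ?thesis unfolding B_def
            by (intro mult_left_mono Suc.IH child_level_ge[OF s _ Suc.prems]) auto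
        qed simp
        finally show "(\<integral>y. (s i * deviation k y (?c s i)) * (s i * deviation k y (?c s i)) \<partial>P) \<le> s i * s i * B" .
      qed
    qed
    finally show ?thesis .
  qed
  have "(\<integral>x. (deviation (Suc k) x t)\<^sup>2 \<partial>P) = (\<integral>x. (\<Sum>i<max_children. \<Sum>j<max_children.
      (x [] i * deviation k (subtree i x) (?c (x []) i)) * (x [] j * deviation k (subtree j x) (?c (x []) j))) \<partial>P)"
  proof (rule integral_cong_AE)
    show "AE x in P. (deviation (Suc k) x t)\<^sup>2 = (\<Sum>i<max_children. \<Sum>j<max_children.
      (x [] i * deviation k (subtree i x) (?c (x []) i)) * (x [] j * deviation k (subtree j x) (?c (x []) j)))"
      using AE_tree_good
    proof eventually_elim
      fix x assume x: "good_tree x"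
      show "(deviation (Suc k) x t)\<^sup>2 = (\<Sum>i<max_children. \<Sum>j<max_children.
          (x [] i * deviation k (subtree i x) (?c (x []) i)) * (x [] j * deviation k (subtree j x) (?c (x []) j)))"
        unfolding deviation_step[OF x level_nonneg[OF Suc.prems]] power2_eq_square sum_product ..
    qed
  qed measurable
  also have "\<dots> = (\<Sum>i<max_children. \<Sum>j<max_children. E i j)"
  proof -
    have "integrable P (\<lambda>x. (x [] i * deviation k (subtree i x) (?c (x []) i)) * (x [] j * deviation k (subtree j x) (?c (x []) j)))" for i j
      by (rule P.integrable_const_bound[where B = D])
         (auto intro!: AE_I2 prod_bound subtree_in_space simp: space_P)
    then show ?thesis unfolding E_def by (simp add: Bochner_Integration.integral_sum)
  qed
  also have "\<dots> = (\<Sum>i<max_children. E i i)"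
  proof (rule sum.cong[OF refl])
    fix i assume "i \<in> {..<max_children}"
    then show "(\<Sum>j<max_children. E i j) = E i i"
      using off by (subst sum.remove[of _ i]) (auto intro!: sum.neutral)
  qed
  also have "\<dots> \<le> (\<Sum>i<max_children. \<integral>s. s i * s i * B \<partial>\<nu>)" by (intro sum_mono diag)
  also have "\<dots> = (\<integral>s. (\<Sum>i<max_children. s i * s i * B) \<partial>\<nu>)"
    by (rule Bochner_Integration.integral_sum[symmetric], rule integrable_mass_square)
  also have "\<dots> \<le> exp (- a) * B"
  proof (rule integral_le_const)
    show "integrable \<nu> (\<lambda>s. \<Sum>i<max_children. s i * s i * B)"
      by (intro Bochner_Integration.integrable_sum integrable_mass_square)
    show "AE s in \<nu>. (\<Sum>i<max_children. s i * s i * B) \<le> exp (- a) * B"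
      using AE_good
    proof eventually_elim
      fix s assume s: "good s"
      have "(\<Sum>i<max_children. s i * s i) \<le> (\<Sum>i<max_children. s i * exp (- a))"
        by (intro sum_mono mult_left_mono good_le s ranked_nonneg good_ranked)
      also have "\<dots> = exp (- a)" using good_sum[OF s] by (simp flip: sum_distrib_right)
      finally show "(\<Sum>i<max_children. s i * s i * B) \<le> exp (- a) * B"
        by (simp add: B_def flip: sum_distrib_right) (simp add: mult_right_mono)
    qed
  qed
  also have "\<dots> = (2 * C)\<^sup>2 * exp (- a * real (Suc k))"
    by (simp add: B_def algebra_simps exp_add[symmetric])
  finally show ?case .
qed

lemma cond_sum_near_limit:
  assumes "\<And>u. t - real k * b \<le> u \<Longrightarrow> \<bar>mean_sum u - l\<bar> \<le> e" "good_tree x" "0 \<le> e"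
  shows "\<bar>cond_sum k x t - l\<bar> \<le> e"
  using assms(1,2)
proof (induction k arbitrary: x t)
  case (Suc k)
  have x: "good (x [])" using Suc.prems by simp
  have diff: "cond_sum (Suc k) x t - l = (\<Sum>i<max_children. x [] i * (cond_sum k (subtree i x) (t + ln (x [] i)) - l))"
    using good_sum[OF x] by (simp add: right_diff_distrib sum_subtractf flip: sum_distrib_right)
  show ?case
    unfolding diff
  proof (intro weighted_sum_bound good_ranked x assms(3) Suc.IH good_tree_subtree Suc.prems(2))
    fix i u assume "x [] i \<noteq> 0" "t + ln (x [] i) - real k * b \<le> u"
    then show "\<bar>mean_sum u - l\<bar> \<le> e"
      using child_level[OF x, of i t] by (intro Suc.prems(1)) (auto simp: algebra_simps)
  qed
qed simp

text \<open>At level \<open>t = n \<delta>\<close>, condition on about \<open>t / (2 b)\<close> generations. Then all fragments of the last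
  generation still have levels of at least \<open>t / 2\<close>, where the mean is near its limit, while the second
  moments of the deviations decay geometrically in \<open>n\<close>.\<close>
theorem converges_on_grid:
  assumes "0 < \<delta>"
  shows "AE x in P. (\<lambda>n. stopped_sum \<phi> x (real n * \<delta>)) \<longlonglongrightarrow> overshoot_mean \<phi>"
proof -
  define k where "k n = nat \<lfloor>real n * \<delta> / (2 * b)\<rfloor>" for n
  have b: "0 < b" using a_pos a_less_b by simp
  have k: "real (k n) \<le> real n * \<delta> / (2 * b)" "real n * \<delta> / (2 * b) - 1 \<le> real (k n)" for n
    using b assms by (auto simp: k_def)
  have kb: "real (k n) * b \<le> real n * \<delta> / 2" for n
    using k(1)[of n] b by (simp add: field_simps)
  have level: "real (k n) * b \<le> real n * \<delta>" for n
    using order_trans[OF kb[of n], of "real n * \<delta>"] assms by simp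
  let ?q = "exp (- a * \<delta> / (2 * b))"
  have q: "0 \<le> ?q" "?q < 1" using a_pos b assms by auto
  have moment: "(\<integral>x. (deviation (k n) x (real n * \<delta>))\<^sup>2 \<partial>P) \<le> (2 * C)\<^sup>2 * exp a * ?q ^ n" for n
  proof -
    have "a * (real n * \<delta> / (2 * b) - 1) \<le> a * real (k n)"
      using k(2)[of n] a_pos by (intro mult_left_mono) auto
    then have "exp (- a * real (k n)) \<le> exp (a + real n * (- a * \<delta> / (2 * b)))"
      by (simp add: algebra_simps)
    also have "\<dots> = exp a * ?q ^ n" by (simp only: exp_add exp_of_nat_mult)
    finally have "(2 * C)\<^sup>2 * exp (- a * real (k n)) \<le> (2 * C)\<^sup>2 * (exp a * ?q ^ n)"
      by (rule mult_left_mono) simp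
    then show ?thesis using deviation_second_moment[OF level, of n] by (simp add: mult.assoc)
  qed
  have "AE x in P. (\<lambda>n. deviation (k n) x (real n * \<delta>)) \<longlonglongrightarrow> 0"
  proof (rule P.AE_tendsto_zero_of_summable_second_moments)
    show "integrable P (\<lambda>x. (deviation (k n) x (real n * \<delta>))\<^sup>2)" for n
      by (rule deviation_square_integrable)
    have "summable (\<lambda>n. (2 * C)\<^sup>2 * exp a * ?q ^ n)"
      using q by (intro summable_mult summable_geometric) auto
    then show "summable (\<lambda>n. \<integral>x. (deviation (k n) x (real n * \<delta>))\<^sup>2 \<partial>P)"
      by (rule summable_comparison_test') (use moment in auto)
  qed measurable
  with AE_tree_good show ?thesis
  proof eventually_elim
    fix x assume x: "good_tree x" and Z0: "(\<lambda>n. deviation (k n) x (real n * \<delta>)) \<longlonglongrightarrow> 0"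
    have "(\<lambda>n. cond_sum (k n) x (real n * \<delta>)) \<longlonglongrightarrow> overshoot_mean \<phi>"
    proof (rule tendstoI)
      fix e :: real assume e: "0 < e"
      obtain u0 where u0: "\<And>u. u0 \<le> u \<Longrightarrow> \<bar>mean_sum u - overshoot_mean \<phi>\<bar> < e / 2"
        using tendstoD[OF mean_sum_limit, of "e / 2"] e
        unfolding eventually_at_top_linorder dist_real_def by auto
      have "filterlim (\<lambda>n. real n * (\<delta> / 2)) at_top sequentially"
        using assms by (intro filterlim_at_top_mult_tendsto_pos[OF tendsto_const _ filterlim_real_sequentially]) auto
      then have "\<forall>\<^sub>F n in sequentially. u0 \<le> real n * (\<delta> / 2)"
        by (auto simp: filterlim_at_top)
      then show "\<forall>\<^sub>F n in sequentially. dist (cond_sum (k n) x (real n * \<delta>)) (overshoot_mean \<phi>) < e"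
      proof eventually_elim
        fix n assume n: "u0 \<le> real n * (\<delta> / 2)"
        have "\<bar>cond_sum (k n) x (real n * \<delta>) - overshoot_mean \<phi>\<bar> \<le> e / 2"
        proof (rule cond_sum_near_limit[OF _ x])
          fix u assume "real n * \<delta> - real (k n) * b \<le> u"
          then have "u0 \<le> u" using n kb[of n] by simp
          then show "\<bar>mean_sum u - overshoot_mean \<phi>\<bar> \<le> e / 2" using u0 by (auto intro: less_imp_le)
        qed (use e in simp)
        then show "dist (cond_sum (k n) x (real n * \<delta>)) (overshoot_mean \<phi>) < e"
          using e by (simp add: dist_real_def)
      qed
    qed
    from tendsto_add[OF Z0 this] show "(\<lambda>n. stopped_sum \<phi> x (real n * \<delta>)) \<longlonglongrightarrow> overshoot_mean \<phi>"
      by (simp add: deviation_def)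
  qed
qed

end

section \<open>From a grid of levels to all levels\<close>

context fragmentation_functional
begin

text \<open>Takes a sequence of grids with meshes \<open>\<delta> p\<close> tending to 0. The interpolation error on the \<open>p\<close>-th grid
  is a stopped sum for \<open>\<psi> p\<close>, whose limit \<open>overshoot_mean (\<psi> p)\<close> tends to 0.\<close>
theorem converges_almost_surely:
  assumes modulus: "\<And>e. 0 < e \<Longrightarrow> \<exists>\<delta>>0. \<forall>y r. 0 \<le> r \<longrightarrow> r \<le> \<delta> \<longrightarrow> r < y \<longrightarrow> \<bar>\<phi> (y - r) - \<phi> y\<bar> \<le> e"
  shows "AE x in P. good_tree x \<and> ((\<lambda>T. stopped_sum \<phi> x T) \<longlongrightarrow> overshoot_mean \<phi>) at_top"
proof -
  define e where "e p = 1 / real (Suc p)" for p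
  have e: "0 < e p" "e p \<le> 1" for p by (auto simp: e_def)
  obtain d where d: "\<And>p. 0 < d p"
    "\<And>p y r. 0 \<le> r \<Longrightarrow> r \<le> d p \<Longrightarrow> r < y \<Longrightarrow> \<bar>\<phi> (y - r) - \<phi> y\<bar> \<le> e p"
    using modulus[OF e(1)] by metis
  define \<delta> where "\<delta> p = min (d p) (e p)" for p
  have \<delta>: "0 < \<delta> p" "\<delta> p \<le> d p" "\<delta> p \<le> e p" for p
    using d(1) e(1) by (auto simp: \<delta>_def)
  define \<psi> where "\<psi> p y = e p + 2 * C * indicator {0<..\<delta> p} y" for p and y :: real
  have \<psi>: "fragmentation_functional h a b \<nu> (\<psi> p) (1 + 2 * C)" for p
  proof unfold_locales
    show "\<psi> p \<in> borel_measurable borel" unfolding \<psi>_def by measurable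
    show "\<bar>\<psi> p y\<bar> \<le> 1 + 2 * C" for y
      using e[of p] C_nonneg by (auto simp: \<psi>_def indicator_def)
  qed
  define K where "K = 1 + 2 * C / mean"
  have K: "0 < K" using C_nonneg mean_pos by (auto simp: K_def intro!: add_pos_nonneg)
  have \<psi>_mean: "overshoot_mean (\<psi> p) \<le> K * e p" for p
  proof -
    have "overshoot_mean (\<psi> p) \<le> e p + 2 * C * \<delta> p / mean"
      using overshoot_mean_bound[of "e p" "2 * C" "\<delta> p"] e[of p] \<delta>[of p] C_nonneg
      by (simp add: \<psi>_def[abs_def])
    also have "\<dots> \<le> e p + 2 * C * e p / mean"
      using \<delta>(3)[of p] C_nonneg mean_pos by (intro add_left_mono divide_right_mono mult_left_mono) auto
    finally show ?thesis by (simp add: K_def algebra_simps)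
  qed
  have "AE x in P. \<forall>p. (\<lambda>n. stopped_sum \<phi> x (real n * \<delta> p)) \<longlonglongrightarrow> overshoot_mean \<phi>"
    unfolding AE_all_countable by (intro allI converges_on_grid \<delta>)
  moreover have "AE x in P. \<forall>p. (\<lambda>n. stopped_sum (\<psi> p) x (real n * \<delta> p)) \<longlonglongrightarrow> overshoot_mean (\<psi> p)"
    unfolding AE_all_countable by (intro allI fragmentation_functional.converges_on_grid[OF \<psi>] \<delta>)
  ultimately show ?thesis
    using AE_tree_good
  proof eventually_elim
    fix x
    assume \<phi>_lim: "\<forall>p. (\<lambda>n. stopped_sum \<phi> x (real n * \<delta> p)) \<longlonglongrightarrow> overshoot_mean \<phi>"
      and \<psi>_lim: "\<forall>p. (\<lambda>n. stopped_sum (\<psi> p) x (real n * \<delta> p)) \<longlonglongrightarrow> overshoot_mean (\<psi> p)"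
      and x: "good_tree x"
    have "((\<lambda>T. stopped_sum \<phi> x T) \<longlongrightarrow> overshoot_mean \<phi>) at_top"
    proof (rule tendstoI)
      fix \<epsilon> :: real assume \<epsilon>: "0 < \<epsilon>"
      obtain p where "inverse (real (Suc p)) < \<epsilon> / (3 * K)"
        using reals_Archimedean[of "\<epsilon> / (3 * K)"] \<epsilon> K by auto
      then have p: "K * e p < \<epsilon> / 3"
        using K by (simp add: e_def field_simps)
      have "\<forall>\<^sub>F n in sequentially. dist (stopped_sum \<phi> x (real n * \<delta> p)) (overshoot_mean \<phi>) < \<epsilon> / 3
          \<and> dist (stopped_sum (\<psi> p) x (real n * \<delta> p)) (overshoot_mean (\<psi> p)) < \<epsilon> / 3"
        using \<phi>_lim \<psi>_lim \<epsilon> by (intro eventually_conj tendstoD) simp_all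
      then obtain n0 where n0: "\<And>n. n0 \<le> n \<Longrightarrow> dist (stopped_sum \<phi> x (real n * \<delta> p)) (overshoot_mean \<phi>) < \<epsilon> / 3"
        "\<And>n. n0 \<le> n \<Longrightarrow> dist (stopped_sum (\<psi> p) x (real n * \<delta> p)) (overshoot_mean (\<psi> p)) < \<epsilon> / 3"
        unfolding eventually_sequentially by blast
      show "\<forall>\<^sub>F T in at_top. dist (stopped_sum \<phi> x T) (overshoot_mean \<phi>) < \<epsilon>"
        unfolding eventually_at_top_linorder
      proof (intro exI allI impI)
        fix T assume T: "real n0 * \<delta> p \<le> T"
        define n where "n = nat \<lfloor>T / \<delta> p\<rfloor>"
        define r where "r = T - real n * \<delta> p"
        have "real n0 \<le> T / \<delta> p" using T \<delta>(1)[of p] by (simp add: field_simps)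
        then have n: "n0 \<le> n" "real n \<le> T / \<delta> p" "T / \<delta> p < real n + 1"
          unfolding n_def by linarith+
        have r: "0 \<le> r" "r \<le> \<delta> p"
          using n(2,3) \<delta>(1)[of p] by (simp_all add: r_def field_simps)
        have "\<bar>stopped_sum \<phi> x (real n * \<delta> p + r) - stopped_sum \<phi> x (real n * \<delta> p)\<bar> \<le> stopped_sum (\<psi> p) x (real n * \<delta> p)"
        proof (rule stopped_sum_interpolate[OF x r(1) \<phi>_bounded])
          fix y assume "r < y"
          then have "\<bar>\<phi> (y - r) - \<phi> y\<bar> \<le> e p" using r \<delta>(2)[of p] by (intro d) auto
          then show "\<bar>\<phi> (y - r) - \<phi> y\<bar> \<le> \<psi> p y"
            using C_nonneg by (auto simp: \<psi>_def indicator_def)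
        next
          fix y assume "0 < y" "y \<le> r"
          then show "2 * C \<le> \<psi> p y" using r e(1)[of p] by (simp add: \<psi>_def)
        qed (auto intro: stopped_sum_bounded good_tree_in_space)
        moreover have "real n * \<delta> p + r = T" by (simp add: r_def)
        ultimately have "\<bar>stopped_sum \<phi> x T - stopped_sum \<phi> x (real n * \<delta> p)\<bar> \<le> stopped_sum (\<psi> p) x (real n * \<delta> p)" by simp
        then show "dist (stopped_sum \<phi> x T) (overshoot_mean \<phi>) < \<epsilon>"
          using n0[OF n(1)] p \<psi>_mean[of p] unfolding dist_real_def by linarith
      qed
    qed
    with x show "good_tree x \<and> ((\<lambda>T. stopped_sum \<phi> x T) \<longlongrightarrow> overshoot_mean \<phi>) at_top" ..
  qed
qed

end

section \<open>Stopped fragments as frozen nodes\<close>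

abbreviation mass :: "(node \<Rightarrow> nat \<Rightarrow> real) \<Rightarrow> node \<Rightarrow> real" where
  "mass x u \<equiv> frag_size (\<lambda>u x. x u) x u"

lemma frag_size_eq_mass: "frag_size X \<omega> u = mass (\<lambda>v. X v \<omega>) u"
  by (induction u) auto

lemma mass_subtree: "mass x (w @ [i]) = x [] i * mass (subtree i x) w"
  by (induction w) (auto simp: subtree_def)

text \<open>The frozen nodes of positive mass, except that the root also counts when \<open>t < 0\<close>. With this
  convention the recursion over the children holds from every level \<open>t \<ge> 0\<close> on, although the children
  may face negative levels.\<close>
definition stopping_line :: "(node \<Rightarrow> nat \<Rightarrow> real) \<Rightarrow> real \<Rightarrow> node set" where
  "stopping_line x t = {u. 0 < mass x u \<and> mass x u < exp (- t) \<and> (u = [] \<or> exp (- t) \<le> mass x (tl u))}"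

context fragmentation
begin

lemma mass_bounds: "good_tree x \<Longrightarrow> 0 \<le> mass x u \<and> mass x u \<le> 1"
proof (induction u)
  case (Cons i u)
  have "0 \<le> x u i" "x u i \<le> exp (- a)"
    using Cons.prems good_ranked ranked_nonneg good_le by blast+
  moreover have "exp (- a) \<le> 1" using a_pos by simp
  ultimately have "0 \<le> x u i" "x u i \<le> 1" by linarith+
  then show ?case using Cons by (auto intro!: mult_le_one)
qed simp

lemma stopping_line_neg:
  assumes "good_tree x" "t < 0"
  shows "stopping_line x t = {[]}"
proof -
  have "mass x u < exp (- t)" for u
    using mass_bounds[OF assms(1), of u] assms(2) by (auto intro: le_less_trans)
  then show ?thesis unfolding stopping_line_def
    by (auto simp: not_le) (use not_le in blast)
qed

lemma stopping_line_step:
  assumes "good_tree x" "0 \<le> t"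
  shows "stopping_line x t = (\<Union>i\<in>{i. i < max_children \<and> x [] i \<noteq> 0}. (\<lambda>w. w @ [i]) ` stopping_line (subtree i x) (t + ln (x [] i)))"
proof -
  have iff: "w @ [i] \<in> stopping_line x t \<longleftrightarrow> w \<in> stopping_line (subtree i x) (t + ln (x [] i))"
    if "x [] i \<noteq> 0" for i w
  proof -
    have pos: "0 < x [] i" using good_range[of "x []" i] assms(1) that by blast
    then have e: "exp (- (t + ln (x [] i))) = exp (- t) / x [] i"
      by (simp add: exp_diff)
    have "tl (w @ [i]) = tl w @ [i]" if "w \<noteq> []" using that by (cases w) auto
    then show ?thesis
      using pos assms(2) unfolding stopping_line_def e
      by (cases "w = []") (auto simp: mass_subtree field_simps zero_less_mult_iff)
  qed
  show ?thesis
  proof (intro set_eqI iffI)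
    fix u assume u: "u \<in> stopping_line x t"
    then have "u \<noteq> []" using assms(2) by (auto simp: stopping_line_def)
    then obtain w i where w: "u = w @ [i]" by (cases u rule: rev_cases) auto
    have "x [] i \<noteq> 0" using u by (auto simp: w stopping_line_def mass_subtree)
    moreover have "i < max_children" using calculation good_tail[of "x []" i] assms(1) by (meson not_le)
    ultimately show "u \<in> (\<Union>i\<in>{i. i < max_children \<and> x [] i \<noteq> 0}. (\<lambda>w. w @ [i]) ` stopping_line (subtree i x) (t + ln (x [] i)))"
      using u iff w by blast
  qed (use iff in auto)
qed

text \<open>The overshoot of a node is \<open>- t - ln m\<close> for its mass \<open>m\<close>, and \<open>exp (- (- t - ln m)) = m / exp (- t)\<close> is
  the ratio at which \<open>f\<close> is evaluated.\<close>
lemma sum_stopping_line: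
  assumes "good_tree x" "t < real n * a"
  shows "finite (stopping_line x t) \<and>
    (\<Sum>u\<in>stopping_line x t. mass x u * \<phi> (- t - ln (mass x u))) = stopped_sum \<phi> x t"
  using assms
proof (induction n arbitrary: x t)
  case 0
  then show ?case by (simp add: stopping_line_neg stopped_sum_neg)
next
  case (Suc n)
  show ?case
  proof (cases "t < 0")
    case True
    then show ?thesis using Suc.prems by (simp add: stopping_line_neg stopped_sum_neg)
  next
    case False
    let ?I = "{i. i < max_children \<and> x [] i \<noteq> 0}" and ?c = "\<lambda>i. t + ln (x [] i)"
    let ?L = "\<lambda>i. stopping_line (subtree i x) (?c i)"
    have IH: "finite (?L i)"
      "(\<Sum>w\<in>?L i. mass (subtree i x) w * \<phi> (- ?c i - ln (mass (subtree i x) w))) = stopped_sum \<phi> (subtree i x) (?c i)"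
      if "x [] i \<noteq> 0" for i
    proof -
      have "?c i \<le> t - a" using child_level[of "x []" i t] that Suc.prems(1) by blast
      then have "?c i < real n * a" using Suc.prems(2) by (simp add: algebra_simps)
      from Suc.IH[OF good_tree_subtree[OF Suc.prems(1)] this]
      show "finite (?L i)"
        "(\<Sum>w\<in>?L i. mass (subtree i x) w * \<phi> (- ?c i - ln (mass (subtree i x) w))) = stopped_sum \<phi> (subtree i x) (?c i)"
        by auto
    qed
    have line: "stopping_line x t = (\<Union>i\<in>?I. (\<lambda>w. w @ [i]) ` ?L i)"
      using False Suc.prems(1) by (intro stopping_line_step) auto
    have "(\<Sum>u\<in>stopping_line x t. mass x u * \<phi> (- t - ln (mass x u)))
        = (\<Sum>i\<in>?I. \<Sum>u\<in>(\<lambda>w. w @ [i]) ` ?L i. mass x u * \<phi> (- t - ln (mass x u)))"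
      unfolding line by (intro sum.UNION_disjoint) (use IH(1) in auto)
    also have "\<dots> = (\<Sum>i\<in>?I. x [] i * stopped_sum \<phi> (subtree i x) (?c i))"
    proof (rule sum.cong[OF refl])
      fix i assume i: "i \<in> ?I"
      then have pos: "0 < x [] i" using good_range[of "x []" i] Suc.prems(1) by blast
      have "(\<Sum>u\<in>(\<lambda>w. w @ [i]) ` ?L i. mass x u * \<phi> (- t - ln (mass x u)))
          = (\<Sum>w\<in>?L i. x [] i * (mass (subtree i x) w * \<phi> (- ?c i - ln (mass (subtree i x) w))))"
        by (subst sum.reindex)
           (use pos in \<open>auto simp: inj_on_def mass_subtree stopping_line_def ln_mult mult.assoc
             diff_diff_eq add_ac intro!: sum.cong\<close>)
      also have "\<dots> = x [] i * stopped_sum \<phi> (subtree i x) (?c i)"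
        using IH(2)[of i] i by (simp flip: sum_distrib_left)
      finally show "(\<Sum>u\<in>(\<lambda>w. w @ [i]) ` ?L i. mass x u * \<phi> (- t - ln (mass x u)))
          = x [] i * stopped_sum \<phi> (subtree i x) (?c i)" .
    qed
    also have "\<dots> = (\<Sum>i<max_children. x [] i * stopped_sum \<phi> (subtree i x) (?c i))"
      by (rule sum.mono_neutral_left) auto
    also have "\<dots> = stopped_sum \<phi> x t"
      using False by (intro stopped_sum_step[OF Suc.prems(1), symmetric]) simp
    finally show ?thesis using IH(1) line by auto
  qed
qed

lemma gamma_frag_eq_stopped_sum:
  assumes good: "good_tree (\<lambda>u. X u \<omega>)" and "0 \<le> T"
    and \<phi>: "\<And>y. 0 < y \<Longrightarrow> \<phi> y = f (exp (- y))"
  shows "gamma_frag X f T \<omega> = stopped_sum \<phi> (\<lambda>u. X u \<omega>) T"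
proof -
  let ?x = "\<lambda>u. X u \<omega>"
  note nonneg = mass_bounds[OF good, THEN conjunct1]
  have "gamma_frag X f T \<omega> = (\<Sum>\<^sub>\<infinity>u\<in>stopping_line ?x T. mass ?x u * \<phi> (- T - ln (mass ?x u)))"
    unfolding gamma_frag_def
  proof (rule infsum_cong_neutral)
    fix u assume "u \<in> stopping_line ?x T - frozen_nodes X \<omega> (exp (- T))"
    then show "mass ?x u * \<phi> (- T - ln (mass ?x u)) = 0"
      using assms(2) by (auto simp: stopping_line_def frozen_nodes_def frag_size_eq_mass[of X])
  next
    fix u assume "u \<in> frozen_nodes X \<omega> (exp (- T)) - stopping_line ?x T"
    then have "\<not> 0 < mass ?x u"
      by (auto simp: stopping_line_def frozen_nodes_def frag_size_eq_mass[of X])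
    then have "mass ?x u = 0" using nonneg[of u] by simp
    then show "frag_size X \<omega> u * f (frag_size X \<omega> u / exp (- T)) = 0"
      by (simp add: frag_size_eq_mass[of X])
  next
    fix u assume "u \<in> frozen_nodes X \<omega> (exp (- T)) \<inter> stopping_line ?x T"
    then have m: "0 < mass ?x u" "mass ?x u < exp (- T)" by (auto simp: stopping_line_def)
    then have "ln (mass ?x u) < - T" by (metis exp_gt_zero ln_exp ln_less_cancel_iff)
    then have "\<phi> (- T - ln (mass ?x u)) = f (exp (T + ln (mass ?x u)))"
      by (subst \<phi>) (auto simp: add.commute)
    also have "exp (T + ln (mass ?x u)) = mass ?x u / exp (- T)"
      using m by (simp add: exp_add exp_minus field_simps)
    finally show "frag_size X \<omega> u * f (frag_size X \<omega> u / exp (- T)) = mass ?x u * \<phi> (- T - ln (mass ?x u))"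
      by (simp add: frag_size_eq_mass[of X])
  qed
  also have "\<dots> = stopped_sum \<phi> ?x T"
    using sum_stopping_line[OF good level_fuel, of T \<phi>] by simp
  finally show ?thesis .
qed

end

section \<open>The step law\<close>

locale dislocation_setting =
  fixes \<nu> :: "(nat \<Rightarrow> real) measure" and \<pi> :: "real measure" and a b :: real and h :: "real \<Rightarrow> real"
  assumes dislocation: "dislocation_measure \<nu>" and conservative: "conservative \<nu>"
    and step_law: "step_law \<nu> \<pi>"
    and a_pos: "0 < a" and a_less_b: "a < b" and support: "measure_support \<pi> = {a..b}"
    and h_continuous_pos: "continuous_on {0<..} h" and h_nonneg_pos: "\<And>x. 0 < x \<Longrightarrow> 0 \<le> h x"
    and density_h: "\<pi> = density (restrict_space lborel {0<..}) (\<lambda>x. ennreal (h x))"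
begin

text \<open>The step law lives on the open half-line. Its density extends continuously by 0, because the support
  stays away from 0.\<close>
definition step_pdf :: "real \<Rightarrow> real" where
  "step_pdf x = (if 0 < x then h x else 0)"

lemma \<pi>_prob: "prob_space \<pi>"
  using step_law by (simp add: step_law_def)

lemma \<nu>_prob: "prob_space \<nu>"
  using dislocation by (simp add: dislocation_measure_def)

lemma sets_\<nu>: "sets \<nu> = sets ranked_masses_space"
  using dislocation by (simp add: dislocation_measure_def)

lemma space_\<pi>: "space \<pi> = {0<..}"
  by (subst density_h) (simp add: space_restrict_space)

lemma measurable_\<pi>: "F \<in> borel_measurable borel \<Longrightarrow> F \<in> borel_measurable \<pi>"
  using step_law by (subst measurable_cong_sets[where M' = "restrict_space borel {0<..}"])
    (auto simp: step_law_def intro: measurable_restrict_space1)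

lemma step_pdf_measurable[measurable]: "step_pdf \<in> borel_measurable borel"
proof -
  have "(\<lambda>x. indicator {0<..} x *\<^sub>R h x) \<in> borel_measurable borel"
    using h_continuous_pos by (intro borel_measurable_continuous_on_indicator) auto
  also have "(\<lambda>x. indicator {0<..} x *\<^sub>R h x) = step_pdf"
    by (auto simp: step_pdf_def fun_eq_iff)
  finally show ?thesis .
qed

lemma emeasure_\<pi>:
  assumes "A \<in> sets borel"
  shows "emeasure \<pi> (A \<inter> {0<..}) = emeasure (density lborel (\<lambda>x. ennreal (step_pdf x))) A"
proof -
  have h_meas: "(\<lambda>x. ennreal (h x)) \<in> borel_measurable (restrict_space lborel {0<..})"
  proof -
    have "h \<in> borel_measurable (restrict_space borel {0<..})"
      using h_continuous_pos by (rule borel_measurable_continuous_on_restrict)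
    then have "h \<in> borel_measurable (restrict_space lborel {0<..})"
      by (subst measurable_cong_sets[OF sets_restrict_space_cong[OF sets_lborel] refl])
    then show ?thesis by simp
  qed
  have "emeasure \<pi> (A \<inter> {0<..})
      = (\<integral>\<^sup>+x. ennreal (h x) * indicator (A \<inter> {0<..}) x \<partial>restrict_space lborel {0<..})"
    unfolding density_h using assms
    by (intro emeasure_density h_meas) (auto simp: sets_restrict_space_iff)
  also have "\<dots> = (\<integral>\<^sup>+x. ennreal (h x) * indicator (A \<inter> {0<..}) x * indicator {0<..} x \<partial>lborel)"
    by (rule nn_integral_restrict_space) auto
  also have "\<dots> = (\<integral>\<^sup>+x. ennreal (step_pdf x) * indicator A x \<partial>lborel)"
    by (intro nn_integral_cong) (auto simp: step_pdf_def split: split_indicator)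
  also have "\<dots> = emeasure (density lborel (\<lambda>x. ennreal (step_pdf x))) A"
    using assms by (intro emeasure_density[symmetric]) auto
  finally show ?thesis .
qed

lemma distr_\<pi>: "distr \<pi> borel (\<lambda>x. x) = density lborel (\<lambda>x. ennreal (step_pdf x))"
proof (rule measure_eqI)
  fix A assume "A \<in> sets (distr \<pi> borel (\<lambda>x. x))"
  then have A: "A \<in> sets borel" by simp
  have "emeasure (distr \<pi> borel (\<lambda>x. x)) A = emeasure \<pi> (A \<inter> {0<..})"
    using A measurable_\<pi>[of "\<lambda>x. x"] by (simp add: emeasure_distr space_\<pi>)
  then show "emeasure (distr \<pi> borel (\<lambda>x. x)) A = emeasure (density lborel (\<lambda>x. ennreal (step_pdf x))) A"
    using emeasure_\<pi>[OF A] by simp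
qed simp

lemma step_pdf_nonneg: "0 \<le> step_pdf x"
  using h_nonneg_pos by (simp add: step_pdf_def)

text \<open>If the density were positive at a point outside the support, it would be positive on a non-empty open
  set that the step law does not charge; that set would be Lebesgue negligible.\<close>
lemma step_pdf_zero:
  assumes "x \<notin> {a..b}"
  shows "step_pdf x = 0"
proof (rule ccontr)
  assume "step_pdf x \<noteq> 0"
  then have x: "0 < x" "0 < h x" using h_nonneg_pos[of x] by (auto simp: step_pdf_def split: if_splits)
  have "x \<notin> measure_support \<pi>" using assms support by simp
  then obtain U where U: "open U" "x \<in> U" "emeasure \<pi> (U \<inter> {0<..}) = 0"
    using x(1) by (auto simp: measure_support_def space_\<pi>)
  define W where "W = {0<..} \<inter> h -` {0<..} \<inter> U"
  have "open ({0<..} \<inter> h -` {0<..})"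
    using h_continuous_pos continuous_on_open_vimage[of "{0<..}" h] by (auto simp: Int_commute)
  then have W: "open W" "x \<in> W" using U x by (auto simp: W_def)
  have "U \<in> null_sets (density lborel (\<lambda>x. ennreal (step_pdf x)))"
    using U emeasure_\<pi>[of U] by (auto simp: null_sets_def)
  then have "AE y in lborel. y \<in> U \<longrightarrow> ennreal (step_pdf y) = 0"
    by (subst (asm) null_sets_density_iff) auto
  then have "AE y in lborel. y \<notin> W"
    by eventually_elim (auto simp: W_def step_pdf_def)
  then have "W \<in> null_sets lborel"
    using W by (subst AE_iff_null_sets) auto
  then have "negligible W"
    unfolding negligible_iff_null_sets by (rule null_sets_completionI)
  then show False using open_not_negligible W by blast
qed

lemma step_pdf_continuous: "continuous_on UNIV step_pdf"
proof -
  have "continuous_on {0<..} step_pdf"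
    using h_continuous_pos by (rule continuous_on_eq) (simp add: step_pdf_def)
  moreover have "continuous_on {..<a} step_pdf"
    using continuous_on_const[of "{..<a}" "0::real"] by (rule continuous_on_eq) (simp add: step_pdf_zero)
  ultimately have "continuous_on ({0<..} \<union> {..<a}) step_pdf"
    by (intro continuous_on_open_Un) auto
  moreover have "{0<..} \<union> {..<a} = UNIV" using a_pos by auto
  ultimately show ?thesis by simp
qed

sublocale step_density step_pdf a b
proof (rule step_density.intro)
  have "prob_space (distr \<pi> borel (\<lambda>x. x))"
    using prob_space.prob_space_distr[OF \<pi>_prob measurable_\<pi>, of "\<lambda>x. x"] by simp
  then show "prob_space (density lborel (\<lambda>x. ennreal (step_pdf x)))" by (simp add: distr_\<pi>)
  then interpret K: prob_space "density lborel (\<lambda>x. ennreal (step_pdf x))" .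
  fix z \<rho> :: real assume z: "z \<in> {a..b}" "0 < \<rho>"
  then have "z \<in> measure_support \<pi>" using support by simp
  then have "0 < emeasure \<pi> ({z - \<rho><..<z + \<rho>} \<inter> space \<pi>)"
    using z(2) by (auto simp: measure_support_def)
  then show "0 < measure (density lborel (\<lambda>x. ennreal (step_pdf x))) {z - \<rho><..<z + \<rho>}"
    by (simp add: space_\<pi> emeasure_\<pi> K.emeasure_eq_measure)
qed (auto intro: a_pos a_less_b step_pdf_continuous step_pdf_nonneg step_pdf_zero)

lemma integral_\<pi>:
  fixes F :: "real \<Rightarrow> real"
  assumes "F \<in> borel_measurable borel"
  shows "(\<integral>x. F x \<partial>\<pi>) = (\<integral>x. F x \<partial>Q)"
  using integral_distr[OF measurable_\<pi>[of "\<lambda>x. x"] assms] by (simp add: distr_\<pi> Q_def)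

lemma mass_measurable[measurable]: "(\<lambda>s. s i) \<in> borel_measurable \<nu>"
  unfolding measurable_cong_sets[OF sets_\<nu> refl]
  by (intro measurable_restrict_space1) measurable

lemma AE_ranked: "AE s in \<nu>. s \<in> ranked_masses"
  using sets_eq_imp_space_eq[OF sets_\<nu>] by (intro AE_I2) (simp add: space_restrict_space)

lemma step_law_integral:
  assumes "F \<in> borel_measurable borel" "\<And>x. 0 \<le> F x" "\<And>x. F x \<le> B"
  shows "(\<integral>s. (\<Sum>i. s i * F (s i)) \<partial>\<nu>) = (\<integral>y. F (exp (- y)) \<partial>Q)"
proof -
  have "bounded (F ` {0..1})"
    using assms(2,3) by (intro boundedI[where B = B]) (auto simp: abs_of_nonneg)
  moreover have "F \<in> borel_measurable (restrict_space borel {0..1})"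
    using assms(1) by (rule measurable_restrict_space1)
  ultimately have "(\<integral>s. (\<Sum>i. s i * F (s i)) \<partial>\<nu>) = (\<integral>y. F (exp (- y)) \<partial>\<pi>)"
    using step_law assms(2) by (auto simp: step_law_def)
  also have "\<dots> = (\<integral>y. F (exp (- y)) \<partial>Q)"
    by (rule integral_\<pi>) (use assms(1) in measurable)
  finally show ?thesis .
qed

lemma ranked_summable_mult:
  assumes "s \<in> ranked_masses" "\<And>x. \<bar>F x\<bar> \<le> B"
  shows "summable (\<lambda>i. s i * F (s i))" "\<bar>\<Sum>i. s i * F (s i)\<bar> \<le> B"
proof -
  have s: "summable s" "(\<Sum>i. s i) \<le> 1" "\<And>i. 0 \<le> s i" using assms(1) by (auto simp: ranked_masses_def)
  have B: "0 \<le> B" using assms(2)[of 0] by linarith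
  have le: "norm (s i * F (s i)) \<le> s i * B" for i
    using s(3)[of i] assms(2)[of "s i"] by (auto simp: abs_mult intro: mult_left_mono)
  have sum: "summable (\<lambda>i. s i * B)" by (rule summable_mult2[OF s(1)])
  show 1: "summable (\<lambda>i. s i * F (s i))"
    by (rule summable_comparison_test'[OF sum]) (rule le)
  have "norm (\<Sum>i. s i * F (s i)) \<le> (\<Sum>i. s i * B)"
    by (rule norm_suminf_le[OF le sum])
  also have "\<dots> = (\<Sum>i. s i) * B" by (rule suminf_mult2[OF s(1), symmetric])
  also have "\<dots> \<le> 1 * B" by (intro mult_right_mono s B)
  finally show "\<bar>\<Sum>i. s i * F (s i)\<bar> \<le> B" by simp
qed

lemma integrable_weighted_sum:
  assumes "F \<in> borel_measurable borel" "\<And>x. \<bar>F x\<bar> \<le> B"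
  shows "integrable \<nu> (\<lambda>s. \<Sum>i. s i * F (s i))"
proof -
  interpret prob_space \<nu> by (rule \<nu>_prob)
  show ?thesis
  proof (rule integrable_const_bound)
    show "AE s in \<nu>. norm (\<Sum>i. s i * F (s i)) \<le> B"
      using AE_ranked by eventually_elim (simp add: ranked_summable_mult(2)[of _ F B] assms(2))
    show "(\<lambda>s. \<Sum>i. s i * F (s i)) \<in> borel_measurable \<nu>"
    proof (rule borel_measurable_suminf)
      note [measurable] = assms(1)
      show "(\<lambda>s. s i * F (s i)) \<in> borel_measurable \<nu>" for i by measurable
    qed
  qed
qed

lemma AE_sum: "AE s in \<nu>. (\<Sum>i. s i) = 1"
  using conservative by (simp add: conservative_def)

text \<open>The step law does not charge the complement of its support, and by size biasing this mass is the
  expected total mass of the fragments whose steps lie there.\<close>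
lemma AE_range_\<nu>: "AE s in \<nu>. \<forall>i. s i = 0 \<or> 0 < s i \<and> - ln (s i) \<in> {a..b}"
proof -
  define F :: "real \<Rightarrow> real" where "F x = (if - ln x \<in> {a..b} then 0 else 1)" for x
  have F: "F \<in> borel_measurable borel" unfolding F_def by measurable
  have bnd: "\<bar>F x\<bar> \<le> 1" and F_nonneg: "0 \<le> F x" for x by (simp_all add: F_def)
  have nonneg: "AE s in \<nu>. 0 \<le> (\<Sum>i. s i * F (s i))"
    using AE_ranked
  proof eventually_elim
    fix s assume "s \<in> ranked_masses"
    then show "0 \<le> (\<Sum>i. s i * F (s i))"
      by (intro suminf_nonneg ranked_summable_mult(1)[OF _ bnd]) (auto simp: F_def ranked_masses_def)
  qed
  have "(\<integral>s. (\<Sum>i. s i * F (s i)) \<partial>\<nu>) = (\<integral>y. F (exp (- y)) \<partial>Q)"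
    by (rule step_law_integral[OF F, of 1]) (auto simp: F_def)
  also have "\<dots> = 0"
    by (rule integral_eq_zero_AE) (use AE_Q in eventually_elim, simp add: F_def)
  finally have "AE s in \<nu>. (\<Sum>i. s i * F (s i)) = 0"
    using integral_nonneg_eq_0_iff_AE[OF integrable_weighted_sum[OF F bnd] nonneg] by simp
  then show ?thesis
    using AE_ranked
  proof eventually_elim
    fix s assume 0: "(\<Sum>i. s i * F (s i)) = 0" and s: "s \<in> ranked_masses"
    have "0 \<le> s i" for i using s by (auto simp: ranked_masses_def)
    moreover have "s i * F (s i) = 0" for i
      using suminf_eq_zero_iff[OF ranked_summable_mult(1)[OF s, of F 1, OF bnd]] 0 calculation F_nonneg
      by simp
    ultimately show "\<forall>i. s i = 0 \<or> 0 < s i \<and> - ln (s i) \<in> {a..b}"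
      by (metis F_def less_eq_real_def mult_eq_0_iff zero_neq_one)
  qed
qed

text \<open>The size-biasing identity is given for non-negative functions; adding the bound \<open>B\<close> to \<open>F\<close> extends it
  to both signs, as conservation makes \<open>\<Sum>\<^sub>i s\<^sub>i B = B\<close>.\<close>
sublocale fragmentation step_pdf a b \<nu>
proof (intro fragmentation.intro fragmentation_axioms.intro)
  show "step_density step_pdf a b" by unfold_locales
  show "prob_space \<nu>" by (rule \<nu>_prob)
  show "sets \<nu> = sets ranked_masses_space" by (rule sets_\<nu>)
  show "AE s in \<nu>. (\<Sum>i. s i) = 1" by (rule AE_sum)
  show "AE s in \<nu>. \<forall>i. s i = 0 \<or> 0 < s i \<and> - ln (s i) \<in> {a..b}" by (rule AE_range_\<nu>)
  fix F :: "real \<Rightarrow> real" and B :: real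
  assume F[measurable]: "F \<in> borel_measurable borel" and bound: "\<And>y. \<bar>F y\<bar> \<le> B"
  interpret prob_space \<nu> by (rule \<nu>_prob)
  have F_ln: "(\<lambda>x. F (- ln x)) \<in> borel_measurable borel" by measurable
  let ?S = "\<lambda>s. \<Sum>i. s i * F (- ln (s i))"
  have int: "integrable \<nu> ?S"
    by (rule integrable_weighted_sum[OF F_ln bound])
  have "(\<integral>s. ?S s \<partial>\<nu>) + B = (\<integral>s. ?S s + B \<partial>\<nu>)"
    using int by (simp add: prob_space)
  also have "\<dots> = (\<integral>s. (\<Sum>i. s i * (F (- ln (s i)) + B)) \<partial>\<nu>)"
  proof (rule integral_cong_AE)
    show "AE s in \<nu>. ?S s + B = (\<Sum>i. s i * (F (- ln (s i)) + B))"
      using AE_ranked AE_sum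
    proof eventually_elim
      fix s assume s: "s \<in> ranked_masses" and 1: "(\<Sum>i. s i) = 1"
      have "summable s" using s by (auto simp: ranked_masses_def)
      then show "?S s + B = (\<Sum>i. s i * (F (- ln (s i)) + B))"
        using suminf_add[OF ranked_summable_mult(1)[OF s, of "\<lambda>x. F (- ln x)" B] summable_mult2[of s B]]
          bound suminf_mult2[of s B] 1
        by (simp add: distrib_left)
    qed
  qed (auto intro!: borel_measurable_suminf)
  also have "\<dots> = (\<integral>y. F (- ln (exp (- y))) + B \<partial>Q)"
  proof (rule step_law_integral[where B = "2 * B"])
    show "0 \<le> F (- ln x) + B" "F (- ln x) + B \<le> 2 * B" for x
      using bound[of "- ln x"] by (auto simp: abs_le_iff)
  qed measurable
  also have "\<dots> = (\<integral>y. F y \<partial>Q) + B"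
    using integrable_Q_bounded[OF F bound] by (simp add: Q.prob_space[simplified])
  finally show "(\<integral>s. ?S s \<partial>\<nu>) = (\<integral>y. F y \<partial>Q)" by simp
qed

section \<open>The limit law\<close>

text \<open>Fubini exchanges the integrals over \<open>s\<close> and over the step \<open>z\<close>, and \<open>r = s - z\<close> runs through
  \<open>[- z, 0)\<close> as \<open>s\<close> runs through \<open>[0, z)\<close>.\<close>
lemma limit_law_integral:
  fixes f \<phi> :: "real \<Rightarrow> real"
  assumes \<eta>: "limit_law \<pi> \<eta>"
    and \<phi>[measurable]: "\<phi> \<in> borel_measurable borel" and bound: "\<And>y. \<bar>\<phi> y\<bar> \<le> C"
    and f: "continuous_on {0..1} f"
    and \<phi>_f: "\<And>y. 0 < y \<Longrightarrow> \<phi> y = f (exp (- y))"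
  shows "gamma_limit \<eta> f = overshoot_mean \<phi>"
proof -
  have cont: "continuous_on {0..} (\<Phi> f)"
    unfolding \<Phi>_def by (intro continuous_on_compose2[OF f] continuous_intros) auto
  have "bounded (f ` {0..1})" by (intro compact_imp_bounded compact_continuous_image f) auto
  then have bdd: "bounded (\<Phi> f ` {0..})"
    by (rule bounded_subset) (auto simp: \<Phi>_def)
  interpret QL: pair_sigma_finite Q lborel ..
  let ?K = "\<lambda>z s. indicator {0..<z} s * \<phi> (z - s) :: real"
  have "gamma_limit \<eta> f = 1 / (\<integral>x. x \<partial>\<pi>) *
      (LBINT s:{0..}. (\<integral>y. \<Phi> f (y - s) * indicator {0<..} (y - s) \<partial>\<pi>))"
    using \<eta> borel_measurable_continuous_on_restrict[OF cont] bdd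
    unfolding gamma_limit_def limit_law_def by blast
  also have "(\<lambda>s. \<integral>y. \<Phi> f (y - s) * indicator {0<..} (y - s) \<partial>\<pi>)
      = (\<lambda>s. \<integral>y. \<phi> (y - s) * indicator {0<..} (y - s) \<partial>Q)"
  proof
    fix s
    have "(\<integral>y. \<Phi> f (y - s) * indicator {0<..} (y - s) \<partial>\<pi>) = (\<integral>y. \<phi> (y - s) * indicator {0<..} (y - s) \<partial>\<pi>)"
      by (intro Bochner_Integration.integral_cong) (auto simp: \<Phi>_def \<phi>_f split: split_indicator)
    also have "\<dots> = (\<integral>y. \<phi> (y - s) * indicator {0<..} (y - s) \<partial>Q)"
      by (rule integral_\<pi>) measurable
    finally show "(\<integral>y. \<Phi> f (y - s) * indicator {0<..} (y - s) \<partial>\<pi>)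
      = (\<integral>y. \<phi> (y - s) * indicator {0<..} (y - s) \<partial>Q)" .
  qed
  also have "(LBINT s:{0..}. (\<integral>y. \<phi> (y - s) * indicator {0<..} (y - s) \<partial>Q)) = (\<integral>s. (\<integral>z. ?K z s \<partial>Q) \<partial>lborel)"
    unfolding set_lebesgue_integral_def
    by (intro Bochner_Integration.integral_cong refl)
       (auto simp flip: integral_mult_right_zero intro!: Bochner_Integration.integral_cong split: split_indicator)
  also have "\<dots> = (\<integral>z. (\<integral>s. ?K z s \<partial>lborel) \<partial>Q)"
  proof (rule QL.Fubini_integral, rule Bochner_Integration.integrable_bound)
    have "integrable lborel (\<lambda>s. C * indicator {0..<b} s :: real)"
      by (intro integrable_mult_right integrable_bounded_indicator) auto
    then show "integrable (Q \<Otimes>\<^sub>M lborel) (\<lambda>(z, s). C * indicator {0..<b} s :: real)"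
      by (intro QL.Fubini_integrable) (auto simp: case_prod_beta)
    have "AE q in Q \<Otimes>\<^sub>M lborel. fst q \<in> {a..b}"
    proof (rule QL.AE_pair_measure)
      show "{q \<in> space (Q \<Otimes>\<^sub>M lborel). fst q \<in> {a..b}} \<in> sets (Q \<Otimes>\<^sub>M lborel)" by measurable
      show "AE z in Q. AE s in lborel. fst (z, s) \<in> {a..b}"
        using AE_Q by eventually_elim simp
    qed
    then show "AE q in Q \<Otimes>\<^sub>M lborel. norm (case q of (z, s) \<Rightarrow> ?K z s)
        \<le> norm (case q of (z, s) \<Rightarrow> C * indicator {0..<b} s)"
    proof eventually_elim
      fix q :: "real \<times> real" assume "fst q \<in> {a..b}"
      then show "norm (case q of (z, s) \<Rightarrow> ?K z s) \<le> norm (case q of (z, s) \<Rightarrow> C * indicator {0..<b} s)"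
        using order_trans[OF bound abs_ge_self]
        by (auto simp: abs_mult case_prod_beta split: split_indicator)
    qed
  qed (simp add: indicator_def, measurable)
  also have "\<dots> = (\<integral>z. (\<integral>r. indicator {- z..<0} r * \<phi> (- r) \<partial>lborel) \<partial>Q)"
  proof (rule Bochner_Integration.integral_cong[OF refl])
    fix z
    show "(\<integral>s. ?K z s \<partial>lborel) = (\<integral>r. indicator {- z..<0} r * \<phi> (- r) \<partial>lborel)"
      by (subst lborel_integral_real_affine[where c = 1 and t = z])
         (auto intro!: Bochner_Integration.integral_cong split: split_indicator)
  qed
  also have "(\<integral>x. x \<partial>\<pi>) = mean"
    unfolding mean_def by (rule integral_\<pi>) measurable
  finally show ?thesis by (simp add: overshoot_mean_def)
qed

lemma almost_sure_limit:
  fixes M :: "'w measure" and f :: "real \<Rightarrow> real"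
  assumes \<eta>: "limit_law \<pi> \<eta>" and M: "prob_space M" and X: "iid_family M \<nu> X"
    and f: "continuous_on {0..1} f"
  shows "AE \<omega> in M. ((\<lambda>T. gamma_frag X f T \<omega>) \<longlongrightarrow> gamma_limit \<eta> f) at_top"
proof -
  \<comment> \<open>Overshoots are positive; truncating at 0 makes \<open>\<phi>\<close> continuous and bounded on the whole line.\<close>
  define \<phi> where "\<phi> y = f (exp (- max y 0))" for y
  have cont: "continuous_on UNIV \<phi>"
    unfolding \<phi>_def by (intro continuous_on_compose2[OF f] continuous_intros) auto
  have "bounded (f ` {0..1})" by (intro compact_imp_bounded compact_continuous_image f) auto
  then obtain C where "\<forall>y\<in>f ` {0..1}. norm y \<le> C"
    unfolding bounded_iff ..
  then have C: "\<bar>f x\<bar> \<le> C" if "x \<in> {0..1}" for x using that by simp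
  have bound: "\<bar>\<phi> y\<bar> \<le> C" for y unfolding \<phi>_def by (rule C) auto
  have \<phi>_f: "\<phi> y = f (exp (- y))" if "0 < y" for y using that by (simp add: \<phi>_def max_def)
  interpret F: fragmentation_functional step_pdf a b \<nu> \<phi> C
    by unfold_locales (use cont bound in \<open>auto intro: borel_measurable_continuous_onI\<close>)
  have "\<exists>\<delta>>0. \<forall>y r. 0 \<le> r \<longrightarrow> r \<le> \<delta> \<longrightarrow> r < y \<longrightarrow> \<bar>\<phi> (y - r) - \<phi> y\<bar> \<le> e" if "0 < e" for e
  proof -
    have "uniformly_continuous_on {0..1} f" by (intro compact_uniformly_continuous f) auto
    then obtain d where d: "0 < d" "\<And>x y. x \<in> {0..1} \<Longrightarrow> y \<in> {0..1} \<Longrightarrow> \<bar>x - y\<bar> < d \<Longrightarrow> \<bar>f x - f y\<bar> < e"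
      using \<open>0 < e\<close> unfolding uniformly_continuous_on_def dist_real_def by metis
    have "\<bar>\<phi> (y - r) - \<phi> y\<bar> \<le> e" if r: "0 \<le> r" "r \<le> d / 2" "r < y" for y r
    proof -
      have "exp (- (y - r)) - exp (- y) = exp (- (y - r)) * (1 - exp (- r))"
        by (simp add: algebra_simps exp_add[symmetric])
      also have "\<dots> \<le> 1 * r"
        using r exp_ge_add_one_self[of "- r"] by (intro mult_mono) auto
      finally have "\<bar>exp (- (y - r)) - exp (- y)\<bar> < d" using r d(1) by auto
      then have "\<bar>f (exp (- (y - r))) - f (exp (- y))\<bar> < e" using r by (intro d) auto
      then show ?thesis using r \<phi>_f[of y] \<phi>_f[of "y - r"] by simp
    qed
    then show ?thesis using d(1) by (intro exI[of _ "d / 2"]) auto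
  qed
  from F.converges_almost_surely[OF this]
  have "AE x in distr M P (\<lambda>\<omega> u. X u \<omega>). good_tree x \<and> ((\<lambda>T. stopped_sum \<phi> x T) \<longlongrightarrow> overshoot_mean \<phi>) at_top"
    by (simp only: iid_family_distr(2)[OF M X \<nu>_prob])
  from AE_distrD[OF iid_family_distr(1)[OF M X \<nu>_prob] this]
  show ?thesis
  proof eventually_elim
    fix \<omega>
    assume *: "good_tree (\<lambda>u. X u \<omega>) \<and> ((\<lambda>T. stopped_sum \<phi> (\<lambda>u. X u \<omega>) T) \<longlongrightarrow> overshoot_mean \<phi>) at_top"
    have "\<forall>\<^sub>F T in at_top. stopped_sum \<phi> (\<lambda>u. X u \<omega>) T = gamma_frag X f T \<omega>"
      using eventually_ge_at_top[of 0]
      by eventually_elim (rule gamma_frag_eq_stopped_sum[symmetric], use * \<phi>_f in auto)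
    then have "((\<lambda>T. gamma_frag X f T \<omega>) \<longlongrightarrow> overshoot_mean \<phi>) at_top"
      using * by (auto elim: Lim_transform_eventually)
    then show "((\<lambda>T. gamma_frag X f T \<omega>) \<longlongrightarrow> gamma_limit \<eta> f) at_top"
      using limit_law_integral[OF \<eta> F.\<phi>_measurable bound f \<phi>_f] by simp
  qed
qed

end

theorem proposition5p1:
  fixes \<nu> :: "(nat \<Rightarrow> real) measure"
    and \<pi> \<eta> :: "real measure"
    and M :: "'w measure"
    and X :: "node \<Rightarrow> 'w \<Rightarrow> nat \<Rightarrow> real"
    and f :: "real \<Rightarrow> real"
  assumes "dislocation_measure \<nu>"
    and "conservative \<nu>"
    and "step_law \<nu> \<pi>"
    and "\<exists>a b. 0 < a \<and> a < b \<and> measure_support \<pi> = {a..b}"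
    and "has_continuous_density \<pi>"
    and "limit_law \<pi> \<eta>"
    and "prob_space M"
    and "iid_family M \<nu> X"
    and "continuous_on {0..1} f"
  shows "AE \<omega> in M. ((\<lambda>T. gamma_frag X f T \<omega>) \<longlongrightarrow> gamma_limit \<eta> f) at_top"
proof -
  obtain a b where ab: "0 < a" "a < b" "measure_support \<pi> = {a..b}"
    using assms(4) by blast
  obtain h where h: "continuous_on {0<..} h" "\<And>x. 0 < x \<Longrightarrow> 0 \<le> h x"
    "\<pi> = density (restrict_space lborel {0<..}) (\<lambda>x. ennreal (h x))"
    using assms(5) unfolding has_continuous_density_def by blast
  interpret dislocation_setting \<nu> \<pi> a b h
    by unfold_locales (use assms(1-3) ab h in auto)
  show ?thesis by (rule almost_sure_limit) (use assms(6-9) in auto)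
qed

end
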